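(* Let $\mathcal F$ be an algebraically closed and inversive $\sigma$-field of characteristic zero and $\mathcal I=\mathcal I(\rho)=[\mathbb Y^{\mathbf f}-\rho(\mathbf f)\mid\mathbf f\in L_\rho]\subset\mathcal F\{\mathbb Y^\pm\}$ a Laurent binomial $\sigma$-ideal, where $\rho$ is a partial character on $\mathbb Z[x]^n$. Then the perfect closure of $\mathcal I$ is either $[1]$ or a Laurent binomial $\sigma$-ideal whose support lattice is $\mathrm{sat}_P(L_\rho)$.
   Context: A $\sigma$-field is a field $\mathcal F$ with a ring endomorphism $\sigma$ with $\sigma(a)=0$ iff $a=0$; inversive means $\sigma$ bijective. $\mathbb Y=\{y_1,\ldots,y_n\}$ are difference indeterminates. For $p=\sum_i c_ix^i\in\mathbb Z[x]$, $a^p:=\prod_i\sigma^i(a)^{c_i}$; for $\mathbf f\in\mathbb Z[x]^n$, $\mathbb Y^{\mathbf f}:=\prod_iy_i^{f_i}$. $\mathcal F\{\mathbb Y^\pm\}$ is the ring of Laurent difference polynomials (finite $\mathcal F$-linear combinations of the $\mathbb Y^{\mathbf f}$). A $\sigma$-ideal is an ideal closed under $\sigma$; $[S]$ is the $\sigma$-ideal generated by $S$. A Laurent binomial $\sigma$-ideal is one generated by elements $a\mathbb Y^{\mathbf g}+b\mathbb Y^{\mathbf h}$, $a,b\in\mathcal F$; its support lattice is $\{\mathbf f\in\mathbb Z[x]^n\mid\exists c\in\mathcal F\setminus\{0\},\ \mathbb Y^{\mathbf f}-c\in\mathcal I\}$. A partial character $\rho$ on $\mathbb Z[x]^n$ is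 a homomorphism from a $\mathbb Z[x]$-submodule ($\mathbb Z[x]$-lattice) $L_\rho\subset\mathbb Z[x]^n$ to the multiplicative group $\mathcal F\setminus\{0\}$ with $\rho(x\mathbf f)=\sigma(\rho(\mathbf f))$. A $\sigma$-ideal $\mathcal I$ is perfect if $p^a\in\mathcal I$ with $a\in\mathbb N[x]\setminus\{0\}$ implies $p\in\mathcal I$; the perfect closure is the smallest perfect $\sigma$-ideal containing $\mathcal I$. For $m\ge2$ let $\zeta_m=e^{2\pi\mathrm i/m}\in\mathcal F$ be the primitive $m$-th root of unity and $o_m\in\{0,\ldots,m-1\}$ the number with $\sigma(\zeta_m)=\zeta_m^{o_m}$; $o_1=0$. A $\mathbb Z[x]$-lattice $L$ is M-saturated if $m\mathbf f\in L$ implies $(x-o_m)\mathbf f\in L$ for all integers $m\ge1$ and $\mathbf f\in\mathbb Z[x]^n$; $x$-saturated if $x\mathbf f\in L$ implies $\mathbf f\in L$; P-saturated if it is both. $\mathrm{sat}_P(L)$ is the smallest P-saturated $\mathbb Z[x]$-lattice containing $L$. *)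

theory Defs
  imports
    "HOL-Analysis.Finite_Cartesian_Product"
    "HOL-Library.Poly_Mapping"
    "HOL-Computational_Algebra.Polynomial"
begin

locale sigma_field =
  fixes \<sigma> :: "'a::field \<Rightarrow> 'a"
  assumes sigma_add: "\<sigma> (a + b) = \<sigma> a + \<sigma> b"
    and sigma_mult: "\<sigma> (a * b) = \<sigma> a * \<sigma> b"
    and sigma_one: "\<sigma> 1 = 1"
    and sigma_eq_0_iff: "\<sigma> a = 0 \<longleftrightarrow> a = 0"

locale inversive_sigma_field = sigma_field +
  assumes sigma_bij: "bij \<sigma>"

text \<open>
  The module of rank \<open>n = CARD('n)\<close> over the ring of integer polynomials is
  \<^typ>\<open>int poly ^ 'n\<close>, with scalar multiplication \<open>p *s f\<close>.
\<close>

abbreviation xvar :: "int poly" where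
  "xvar \<equiv> [:0, 1:]"

lemma module_Zx: "module ((*s) :: int poly \<Rightarrow> int poly ^ 'n \<Rightarrow> int poly ^ 'n)"
  by unfold_locales
    (simp_all add: vec_eq_iff vector_scalar_mult_def algebra_simps)

definition Zx_lattice :: "(int poly ^ 'n) set \<Rightarrow> bool" where
  "Zx_lattice L \<longleftrightarrow> module.subspace (*s) L"

lemma Zx_lattice_iff:
  "Zx_lattice L \<longleftrightarrow>
     0 \<in> L \<and> (\<forall>f\<in>L. \<forall>g\<in>L. f + g \<in> L) \<and> (\<forall>p. \<forall>f\<in>L. p *s f \<in> L)"
  by (simp add: Zx_lattice_def module.subspace_def[OF module_Zx])

definition partial_character ::
    "('a::field \<Rightarrow> 'a) \<Rightarrow> (int poly ^ 'n) set \<Rightarrow> (int poly ^ 'n \<Rightarrow> 'a) \<Rightarrow> bool" where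
  "partial_character \<sigma> L \<rho> \<longleftrightarrow>
     Zx_lattice L \<and>
     (\<forall>f\<in>L. \<rho> f \<noteq> 0) \<and>
     (\<forall>f\<in>L. \<forall>g\<in>L. \<rho> (f + g) = \<rho> f * \<rho> g) \<and>
     (\<forall>f\<in>L. \<rho> (xvar *s f) = \<sigma> (\<rho> f))"

definition primitive_root_of_unity :: "nat \<Rightarrow> 'a::field \<Rightarrow> bool" where
  "primitive_root_of_unity m z \<longleftrightarrow>
     m > 0 \<and> z ^ m = 1 \<and> (\<forall>k. 0 < k \<and> k < m \<longrightarrow> z ^ k \<noteq> 1)"

text \<open>
  The family \<open>\<zeta>\<close> stands for a choice of a primitive \<open>m\<close>-th root of unity for every \<open>m \<ge> 2\<close>,
  such as the images of \<open>exp (2 * pi * \<i> / m)\<close> under an embedding of the cyclotomic numbers.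
  The exponent below does not depend on that choice: any other primitive \<open>m\<close>-th root
  of unity is a power of \<open>\<zeta> m\<close>. Lemma \<open>sigma_exponent_ex1\<close> justifies the description.
\<close>

definition sigma_exponent :: "('a::field \<Rightarrow> 'a) \<Rightarrow> (nat \<Rightarrow> 'a) \<Rightarrow> nat \<Rightarrow> nat" where
  "sigma_exponent \<sigma> \<zeta> m =
     (if m = 1 then 0 else (THE k. k < m \<and> \<sigma> (\<zeta> m) = \<zeta> m ^ k))"

definition M_saturated ::
    "('a::field \<Rightarrow> 'a) \<Rightarrow> (nat \<Rightarrow> 'a) \<Rightarrow> (int poly ^ 'n) set \<Rightarrow> bool" where
  "M_saturated \<sigma> \<zeta> L \<longleftrightarrow>
     (\<forall>m\<ge>1. \<forall>f. of_nat m *s f \<in> L \<longrightarrow> (xvar - of_nat (sigma_exponent \<sigma> \<zeta> m)) *s f \<in> L)"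

definition x_saturated :: "(int poly ^ 'n) set \<Rightarrow> bool" where
  "x_saturated L \<longleftrightarrow> (\<forall>f. xvar *s f \<in> L \<longrightarrow> f \<in> L)"

definition P_saturated_lattice ::
    "('a::field \<Rightarrow> 'a) \<Rightarrow> (nat \<Rightarrow> 'a) \<Rightarrow> (int poly ^ 'n) set \<Rightarrow> bool" where
  "P_saturated_lattice \<sigma> \<zeta> L \<longleftrightarrow> Zx_lattice L \<and> M_saturated \<sigma> \<zeta> L \<and> x_saturated L"

definition sat_P ::
    "('a::field \<Rightarrow> 'a) \<Rightarrow> (nat \<Rightarrow> 'a) \<Rightarrow> (int poly ^ 'n) set \<Rightarrow> (int poly ^ 'n) set" where
  "sat_P \<sigma> \<zeta> L = P_saturated_lattice \<sigma> \<zeta> hull L"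

text \<open>
  A Laurent difference polynomial is a finite linear combination of the monomials
  \<open>\<bbbY>\<^sup>f\<close> with \<open>\<bbbY>\<^sup>f * \<bbbY>\<^sup>g = \<bbbY>\<^sup>f\<^sup>+\<^sup>g\<close>, that is, an element of the group algebra of
  the additive group \<^typ>\<open>int poly ^ 'n\<close>; the product of \<^typ>\<open>'b \<Rightarrow>\<^sub>0 'a\<close> is convolution.
  The monomial \<open>c * \<bbbY>\<^sup>f\<close> is \<open>Poly_Mapping.single f c\<close>.
\<close>

type_synonym ('a, 'n) laurent = "(int poly ^ 'n) \<Rightarrow>\<^sub>0 'a"

abbreviation lmonom :: "'a::zero \<Rightarrow> int poly ^ 'n \<Rightarrow> ('a, 'n::finite) laurent" where
  "lmonom c f \<equiv> Poly_Mapping.single f c"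

abbreviation lconst :: "'a::zero \<Rightarrow> ('a, 'n::finite) laurent" where
  "lconst c \<equiv> lmonom c 0"

text \<open>
  The monomial \<open>\<bbbY>\<^sup>f\<close> is the product of the powers \<open>(\<sigma>\<^sup>k y\<^sub>i) ^ coeff (f $ i) k\<close>, so \<open>\<sigma>\<close> sends
  \<open>c * \<bbbY>\<^sup>f\<close> to \<open>\<sigma> c * \<bbbY>\<^sup>x\<^sup>f\<close>.
\<close>

definition laurent_sigma ::
    "('a::field \<Rightarrow> 'a) \<Rightarrow> ('a, 'n::finite) laurent \<Rightarrow> ('a, 'n::finite) laurent" where
  "laurent_sigma \<sigma> p =
     (\<Sum>f\<in>Poly_Mapping.keys p. lmonom (\<sigma> (Poly_Mapping.lookup p f)) (xvar *s f))"

definition sigma_power ::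
    "('a::field \<Rightarrow> 'a) \<Rightarrow> ('a, 'n::finite) laurent \<Rightarrow> nat poly \<Rightarrow> ('a, 'n::finite) laurent" where
  "sigma_power \<sigma> p a = (\<Prod>i\<le>degree a. (laurent_sigma \<sigma> ^^ i) p ^ coeff a i)"

lemma module_laurent:
  "module ((*) :: ('a::field, 'n::finite) laurent \<Rightarrow> ('a, 'n::finite) laurent \<Rightarrow> ('a, 'n::finite) laurent)"
  by unfold_locales (simp_all add: algebra_simps)

definition sigma_ideal :: "('a::field \<Rightarrow> 'a) \<Rightarrow> ('a, 'n::finite) laurent set \<Rightarrow> bool" where
  "sigma_ideal \<sigma> I \<longleftrightarrow> module.subspace (*) I \<and> (\<forall>p\<in>I. laurent_sigma \<sigma> p \<in> I)"

lemma sigma_ideal_iff: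
  "sigma_ideal \<sigma> I \<longleftrightarrow>
     0 \<in> I \<and> (\<forall>p\<in>I. \<forall>q\<in>I. p + q \<in> I) \<and> (\<forall>r. \<forall>p\<in>I. r * p \<in> I) \<and>
     (\<forall>p\<in>I. laurent_sigma \<sigma> p \<in> I)"
  by (simp add: sigma_ideal_def module.subspace_def[OF module_laurent])

definition generated_sigma_ideal ::
    "('a::field \<Rightarrow> 'a) \<Rightarrow> ('a, 'n::finite) laurent set \<Rightarrow> ('a, 'n::finite) laurent set" where
  "generated_sigma_ideal \<sigma> S = sigma_ideal \<sigma> hull S"

definition perfect_sigma_ideal ::
    "('a::field \<Rightarrow> 'a) \<Rightarrow> ('a, 'n::finite) laurent set \<Rightarrow> bool" where
  "perfect_sigma_ideal \<sigma> I \<longleftrightarrow>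
     sigma_ideal \<sigma> I \<and> (\<forall>p a. a \<noteq> 0 \<and> sigma_power \<sigma> p a \<in> I \<longrightarrow> p \<in> I)"

definition perfect_closure ::
    "('a::field \<Rightarrow> 'a) \<Rightarrow> ('a, 'n::finite) laurent set \<Rightarrow> ('a, 'n::finite) laurent set" where
  "perfect_closure \<sigma> I = perfect_sigma_ideal \<sigma> hull I"

definition laurent_binomial_sigma_ideal ::
    "('a::field \<Rightarrow> 'a) \<Rightarrow> ('a, 'n::finite) laurent set \<Rightarrow> bool" where
  "laurent_binomial_sigma_ideal \<sigma> I \<longleftrightarrow>
     (\<exists>S \<subseteq> {lmonom a g + lmonom b h | a b g h. True}. I = generated_sigma_ideal \<sigma> S)"

definition support_lattice :: "('a::field, 'n::finite) laurent set \<Rightarrow> (int poly ^ 'n) set" where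
  "support_lattice I = {f. \<exists>c. c \<noteq> 0 \<and> lmonom 1 f - lconst c \<in> I}"

definition character_ideal ::
    "('a::field \<Rightarrow> 'a) \<Rightarrow> (int poly ^ 'n) set \<Rightarrow> (int poly ^ 'n \<Rightarrow> 'a) \<Rightarrow> ('a, 'n::finite) laurent set" where
  "character_ideal \<sigma> L \<rho> = generated_sigma_ideal \<sigma> {lmonom 1 f - lconst (\<rho> f) | f. f \<in> L}"

lemma sigma_exponent_ex1:
  fixes \<sigma> :: "'a::field \<Rightarrow> 'a"
  assumes "sigma_field \<sigma>" and "primitive_root_of_unity m z"
  shows "\<exists>!k. k < m \<and> \<sigma> z = z ^ k"
proof -
  interpret sigma_field \<sigma> by fact
  have m: "m > 0" and zm: "z ^ m = 1" and prim: "\<And>k. 0 < k \<Longrightarrow> k < m \<Longrightarrow> z ^ k \<noteq> 1"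
    using assms(2) by (auto simp: primitive_root_of_unity_def)
  have z0: "z \<noteq> 0" using m zm by (auto simp: zero_power)
  have le: "j = k" if "j \<le> k" "k < m" "z ^ j = z ^ k" for j k
  proof (rule ccontr)
    assume "j \<noteq> k"
    have "z ^ j * z ^ (k - j) = z ^ j * 1"
      using that power_add[of z j "k - j"] by simp
    then have "z ^ (k - j) = 1" using z0 by simp
    moreover have "0 < k - j" "k - j < m" using that \<open>j \<noteq> k\<close> by linarith+
    ultimately show False using prim[of "k - j"] by simp
  qed
  have inj: "inj_on (\<lambda>k. z ^ k) {..<m}"
  proof (rule inj_onI)
    fix j k assume "j \<in> {..<m}" "k \<in> {..<m}" "z ^ j = z ^ k"
    then show "j = k" using le[of j k] le[of k j] by (cases "j \<le> k") auto
  qed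
  define p :: "'a poly" where "p = monom 1 m - 1"
  have deg: "degree p = m"
    unfolding p_def diff_conv_add_uminus using m
    by (subst degree_add_eq_left) (auto simp: degree_monom_eq)
  then have p0: "p \<noteq> 0" using m by auto
  have roots: "{w. poly p w = 0} = {w. w ^ m = 1}"
    by (auto simp: p_def poly_monom)
  have fin: "finite {w::'a. w ^ m = 1}" and card: "card {w::'a. w ^ m = 1} \<le> m"
    using poly_roots_finite[OF p0] card_poly_roots_bound[OF p0] deg roots by auto
  have pow: "(z ^ k) ^ m = 1" for k
    using zm by (simp add: power_mult[symmetric] mult.commute[of k]) (simp add: power_mult)
  have sub: "(\<lambda>k. z ^ k) ` {..<m} \<subseteq> {w. w ^ m = 1}"
    using pow by auto
  have eq: "(\<lambda>k. z ^ k) ` {..<m} = {w. w ^ m = 1}"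
    by (rule card_seteq[OF fin sub]) (use card inj in \<open>simp add: card_image\<close>)
  have spow: "\<sigma> (z ^ k) = \<sigma> z ^ k" for k
    by (induction k) (simp_all add: sigma_one sigma_mult)
  have "\<sigma> z ^ m = 1" using spow[of m] zm sigma_one by simp
  then have "\<sigma> z \<in> (\<lambda>k. z ^ k) ` {..<m}" using eq by simp
  then show ?thesis using inj by (auto simp: inj_on_def)
qed

lemma sat_P_P_saturated: "P_saturated_lattice \<sigma> \<zeta> (sat_P \<sigma> \<zeta> L)"
  unfolding sat_P_def
proof (rule hull_in)
  fix T :: "(int poly ^ 'n) set set"
  assume "\<forall>L\<in>T. P_saturated_lattice \<sigma> \<zeta> L"
  then show "P_saturated_lattice \<sigma> \<zeta> (\<Inter>T)"
    unfolding P_saturated_lattice_def Zx_lattice_iff M_saturated_def x_saturated_def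
    by (intro conjI ballI allI impI InterI; meson InterD)
qed

lemma sigma_ideal_Inter: "\<forall>I\<in>T. sigma_ideal \<sigma> I \<Longrightarrow> sigma_ideal \<sigma> (\<Inter>T)"
  unfolding sigma_ideal_iff
  by (intro conjI ballI allI InterI; meson InterD)

lemma sigma_ideal_generated: "sigma_ideal \<sigma> (generated_sigma_ideal \<sigma> S)"
  unfolding generated_sigma_ideal_def by (rule hull_in) (rule sigma_ideal_Inter)

lemma perfect_sigma_ideal_closure: "perfect_sigma_ideal \<sigma> (perfect_closure \<sigma> I)"
  unfolding perfect_closure_def
proof (rule hull_in)
  fix T :: "('a, 'b) laurent set set"
  assume T: "\<forall>I\<in>T. perfect_sigma_ideal \<sigma> I"
  then have "sigma_ideal \<sigma> (\<Inter>T)"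
    by (intro sigma_ideal_Inter) (simp add: perfect_sigma_ideal_def)
  with T show "perfect_sigma_ideal \<sigma> (\<Inter>T)"
    unfolding perfect_sigma_ideal_def by (meson InterD InterI)
qed

context sigma_field
begin

lemma laurent_sigma_superset:
  fixes p :: "('a, 'n::finite) laurent"
  assumes "finite A" "Poly_Mapping.keys p \<subseteq> A"
  shows "laurent_sigma \<sigma> p = (\<Sum>f\<in>A. lmonom (\<sigma> (Poly_Mapping.lookup p f)) (xvar *s f))"
  unfolding laurent_sigma_def
  by (rule sum.mono_neutral_left)
    (use assms sigma_eq_0_iff[of 0] in \<open>auto simp: in_keys_iff\<close>)

lemma laurent_sigma_lmonom: "laurent_sigma \<sigma> (lmonom c f) = lmonom (\<sigma> c) (xvar *s f)"
  by (subst laurent_sigma_superset[where A = "{f}"]) auto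

lemma laurent_sigma_add:
  fixes p q :: "('a, 'n::finite) laurent"
  shows "laurent_sigma \<sigma> (p + q) = laurent_sigma \<sigma> p + laurent_sigma \<sigma> q"
proof -
  let ?A = "Poly_Mapping.keys p \<union> Poly_Mapping.keys q"
  show ?thesis
    using Poly_Mapping.keys_add[of p q]
    by (simp add: laurent_sigma_superset[where A = ?A] lookup_add sigma_add
        single_add sum.distrib)
qed

end

end

theory Submission
  imports Defs
begin

text \<open>
  Write \<open>G\<close> for the exponent group \<open>\<int>[x]\<^sup>n\<close>. A group homomorphism \<open>\<theta>\<close> from \<open>G\<close> to the
  multiplicative group of the field is a point at which every Laurent difference polynomial
  \<open>p\<close> can be evaluated, and evaluation is a ring homomorphism. The field is algebraically closed
  of characteristic zero, so its multiplicative group is divisible and contains a nontrivial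
  \<open>m\<close>-th root of unity for every \<open>m \<ge> 2\<close>. Hence characters of subgroups extend to \<open>G\<close>, and for
  every \<open>f \<notin> L\<close> some character is trivial on \<open>L\<close> but not at \<open>f\<close>. Dedekind's argument on the
  independence of characters then gives a Nullstellensatz: the ideal generated by the
  binomials \<open>\<bbbY>\<^sup>f - \<theta>(f)\<close> with \<open>f \<in> L\<close> consists of all polynomials that vanish at every character
  which agrees with \<open>\<theta>\<close> on \<open>L\<close> (\<open>vanishing_ideal_coset_partner\<close>, \<open>vanishing_ideal_generated\<close>).
  In particular its support lattice is \<open>L\<close>, and it is the intersection of the ideals that belong
  to the extensions of the character to any larger lattice.

  Let \<open>J\<close> be the perfect closure, and assume that \<open>J\<close> is a proper ideal. Its support lattice
  is P-saturated (\<open>support_lattice_P_saturated\<close>): a perfect ideal is reflexive, which gives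
  \<open>x\<close>-saturation; and if \<open>\<bbbY>\<^sup>m\<^sup>f - d\<^sup>m \<in> J\<close>, this binomial is the product of the
  \<open>\<bbbY>\<^sup>f - d \<zeta>\<^sup>i\<close>, modulo each of which \<open>\<bbbY>\<^sup>x\<^sup>f\<close> is the same constant multiple of \<open>\<bbbY>\<^sup>o\<^sup>f\<close>, where \<open>o\<close>
  is given by \<open>\<sigma>(\<zeta>) = \<zeta>\<^sup>o\<close>. Colon ideals of perfect ideals are perfect, and this
  transfers the relation from the factors to \<open>J\<close>.

  So \<open>J\<close> contains the ideal \<open>V\<close> of a partial character on \<open>L' = sat\<^sub>P(L)\<close>. Since \<open>V\<close> contains the given
  binomials, \<open>J = V\<close> follows once \<open>V\<close> is known to be perfect. Let \<open>S\<close> consist of the \<open>f\<close> with a positive integer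
  multiple in \<open>L'\<close>. The ideal \<open>V\<close> is the intersection of the ideals attached to the extensions of the
  character to \<open>S\<close>. By M-saturation together with \<open>V \<subseteq> J\<close>, each of these extensions
  commutes with \<open>\<sigma>\<close>, so each is again a partial character. Since \<open>G/S\<close> is torsion-free, it can
  be totally ordered, and comparing leading terms shows that the ideals attached to \<open>S\<close> are prime
  (\<open>vanishing_ideal_prime\<close>); since \<open>S\<close> is \<open>x\<close>-saturated they are also reflexive. Reflexive prime
  \<open>\<sigma>\<close>-ideals are perfect, and so are their intersections.
\<close>

section \<open>Characters of the exponent group\<close>

interpretation Zx: module "(*s) :: int poly \<Rightarrow> int poly ^ 'n \<Rightarrow> int poly ^ 'n"
  by (rule module_Zx)

text \<open>
  Meant for the set of integers \<open>k\<close> such that \<open>k f\<close> lies in a given subgroup. There \<open>m\<close> is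
  the order of \<open>f\<close> modulo the subgroup, with \<open>m = 0\<close> for infinite order.
\<close>

lemma int_subgroup_principal:
  fixes A :: "int set"
  assumes "0 \<in> A" and diff: "\<And>k l. k \<in> A \<Longrightarrow> l \<in> A \<Longrightarrow> k - l \<in> A"
  obtains m :: nat where "A = {k. int m dvd k}"
proof (cases "\<exists>m::nat. m > 0 \<and> int m \<in> A")
  case False
  have "k = 0" if "k \<in> A" for k
  proof (rule ccontr)
    assume "k \<noteq> 0"
    moreover have "- k \<in> A" using diff[OF assms(1) that] by simp
    ultimately have "nat \<bar>k\<bar> > 0 \<and> int (nat \<bar>k\<bar>) \<in> A" using that by (auto simp: abs_if)
    with False show False by blast
  qed
  with assms(1) have "A = {k. int 0 dvd k}" by auto
  then show ?thesis by (rule that)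
next
  case True
  define m where "m = (LEAST m::nat. m > 0 \<and> int m \<in> A)"
  have m: "m > 0" "int m \<in> A" using LeastI_ex[OF True] by (auto simp: m_def)
  have least: "\<not> (0 < j \<and> int j \<in> A)" if "j < m" for j
    using not_less_Least[of j "\<lambda>m. m > 0 \<and> int m \<in> A"] that unfolding m_def by blast
  have neg: "- k \<in> A" if "k \<in> A" for k using diff[OF assms(1) that] by simp
  have add: "k + l \<in> A" if "k \<in> A" "l \<in> A" for k l using diff[OF that(1) neg[OF that(2)]] by simp
  have multn: "int q * int m \<in> A" for q
    by (induction q) (use assms(1) add m in \<open>auto simp: algebra_simps\<close>)
  have mult: "q * int m \<in> A" for q
    using multn[of "nat q"] neg[OF multn[of "nat (-q)"]] by (cases "q \<ge> 0") auto
  have "int m dvd k" if "k \<in> A" for k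
  proof -
    have "k mod int m = k - (k div int m) * int m" by (simp add: minus_div_mult_eq_mod)
    then have "k mod int m \<in> A" using diff[OF that mult] by simp
    moreover have "0 \<le> k mod int m" "k mod int m < int m" using m(1) by auto
    ultimately have "k mod int m = 0" using least[of "nat (k mod int m)"] by force
    then show ?thesis by auto
  qed
  moreover have "k \<in> A" if "int m dvd k" for k
    using that mult by (auto simp: dvd_def mult.commute)
  ultimately have "A = {k. int m dvd k}" by blast
  then show ?thesis by (rule that)
qed

definition group_char :: "(int poly ^ 'n \<Rightarrow> 'a::field) \<Rightarrow> bool" where
  "group_char \<theta> \<longleftrightarrow> \<theta> 0 = 1 \<and> (\<forall>f g. \<theta> (f + g) = \<theta> f * \<theta> g)"

text \<open>
  A character of a subgroup of the exponent group, encoded as its graph: graphs are ordered by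
  inclusion, and a union of a chain of graphs is again one, which is the form that Zorn's lemma
  needs. In the presence of the other two clauses, the first one makes the
  relation single-valued and its values nonzero.
\<close>

definition char_graph :: "((int poly ^ 'n) \<times> 'a::field) set \<Rightarrow> bool" where
  "char_graph R \<longleftrightarrow>
     (\<forall>a. (0, a) \<in> R \<longleftrightarrow> a = 1) \<and>
     (\<forall>f a g b. (f, a) \<in> R \<and> (g, b) \<in> R \<longrightarrow> (f + g, a * b) \<in> R) \<and>
     (\<forall>f a. (f, a) \<in> R \<longrightarrow> (- f, inverse a) \<in> R)"

lemma char_graphD:
  assumes "char_graph R"
  shows "(0, 1) \<in> R"
    and "(0, a) \<in> R \<Longrightarrow> a = 1"
    and "(f, a) \<in> R \<Longrightarrow> (g, b) \<in> R \<Longrightarrow> (f + g, a * b) \<in> R"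
    and "(f, a) \<in> R \<Longrightarrow> (- f, inverse a) \<in> R"
  using assms unfolding char_graph_def by auto

lemma char_graph_nonzero:
  assumes "char_graph R" "(f, a) \<in> R" shows "a \<noteq> 0"
  using char_graphD(2)[OF assms(1), of "a * inverse a"]
    char_graphD(3)[OF assms(1) assms(2) char_graphD(4)[OF assms]] by auto

lemma char_graph_unique:
  assumes "char_graph R" "(f, a) \<in> R" "(f, b) \<in> R" shows "a = b"
proof -
  have "a * inverse b = 1"
    using char_graphD(2)[OF assms(1), of "a * inverse b"]
      char_graphD(3)[OF assms(1) assms(2) char_graphD(4)[OF assms(1,3)]] by auto
  then show ?thesis using char_graph_nonzero[OF assms(1,3)] by (simp add: field_simps)
qed

lemma char_graph_multiple:
  assumes R: "char_graph R" and fa: "(f, a) \<in> R"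
  shows "(of_int k *s f, a powi k) \<in> R"
proof -
  have n: "(of_nat j *s f, a ^ j) \<in> R" for j
    by (induction j) (use char_graphD(1,3)[OF R] fa in \<open>auto simp: Zx.scale_left_distrib\<close>)
  show ?thesis
  proof (cases "k \<ge> 0")
    case True
    then show ?thesis using n[of "nat k"] by (simp add: power_int_def)
  next
    case False
    then show ?thesis using char_graphD(4)[OF R n[of "nat (-k)"]]
      by (simp add: power_int_def Zx.scale_minus_left power_inverse)
  qed
qed

text \<open>
  A value \<open>d\<close> may be assigned to \<open>f\<close> as soon as it agrees with the character on those multiples
  of \<open>f\<close> where the character is already defined.
\<close>

lemma char_graph_adjoin:
  fixes d :: "'a::field"
  assumes R: "char_graph R" and "d \<noteq> 0"
    and compat: "\<And>k c. (of_int k *s f, c) \<in> R \<Longrightarrow> c = d powi k"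
  shows "char_graph {(h + of_int k *s f, a * d powi k) | h a k. (h, a) \<in> R}" (is "char_graph ?R")
  unfolding char_graph_def
proof (intro conjI allI impI)
  fix b
  show "(0, b) \<in> ?R \<longleftrightarrow> b = 1"
  proof
    assume "(0, b) \<in> ?R"
    then obtain h a k where *: "h + of_int k *s f = 0" "b = a * d powi k" "(h, a) \<in> R" by auto
    have "of_int k *s f = - h" using *(1) by (simp add: eq_neg_iff_add_eq_0 add.commute)
    then have "inverse a = d powi k" using compat[of k] char_graphD(4)[OF R *(3)] by simp
    then show "b = 1" using *(2) char_graph_nonzero[OF R *(3)] by (metis right_inverse)
  next
    assume "b = 1"
    then have "(0, b) = (0 + of_int 0 *s f, 1 * d powi 0)" by simp
    then show "(0, b) \<in> ?R" using char_graphD(1)[OF R] by blast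
  qed
next
  fix f1 a1 f2 a2 assume "(f1, a1) \<in> ?R \<and> (f2, a2) \<in> ?R"
  then obtain h1 b1 k1 h2 b2 k2 where
    "f1 = h1 + of_int k1 *s f" "a1 = b1 * d powi k1" "(h1, b1) \<in> R"
    "f2 = h2 + of_int k2 *s f" "a2 = b2 * d powi k2" "(h2, b2) \<in> R" by blast
  then have "f1 + f2 = (h1 + h2) + of_int (k1 + k2) *s f"
      "a1 * a2 = (b1 * b2) * d powi (k1 + k2)" "(h1 + h2, b1 * b2) \<in> R"
    using \<open>d \<noteq> 0\<close> char_graphD(3)[OF R]
    by (simp_all add: Zx.scale_left_distrib algebra_simps power_int_add)
  then show "(f1 + f2, a1 * a2) \<in> ?R" by blast
next
  fix f1 a1 assume "(f1, a1) \<in> ?R"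
  then obtain h1 b1 k1 where
    "f1 = h1 + of_int k1 *s f" "a1 = b1 * d powi k1" "(h1, b1) \<in> R" by blast
  then have "- f1 = (- h1) + of_int (- k1) *s f"
      "inverse a1 = inverse b1 * d powi (- k1)" "(- h1, inverse b1) \<in> R"
    using \<open>d \<noteq> 0\<close> char_graphD(4)[OF R]
    by (simp_all add: Zx.scale_minus_left power_int_minus)
  then show "(- f1, inverse a1) \<in> ?R" by blast
qed

text \<open>
  The multiplicative group of an algebraically closed field is divisible, hence injective as an
  abelian group. If a maximal graph misses \<open>f\<close>, let \<open>m\<close> be the order of \<open>f\<close> modulo its domain: an
  \<open>m\<close>-th root of the value at \<open>m f\<close> is an admissible value at \<open>f\<close>.
\<close>

lemma char_graph_extends:
  fixes R0 :: "((int poly ^ 'n) \<times> 'a::alg_closed_field) set"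
  assumes "char_graph R0"
  obtains \<theta> where "group_char \<theta>" "\<And>f a. (f, a) \<in> R0 \<Longrightarrow> \<theta> f = a"
proof -
  let ?A = "{R :: ((int poly ^ 'n) \<times> 'a) set. R0 \<subseteq> R \<and> char_graph R}"
  have "\<Union>C \<in> ?A" if C: "C \<noteq> {}" "subset.chain ?A C" for C
  proof -
    have sub: "C \<subseteq> ?A" and lin: "\<And>X Y. X \<in> C \<Longrightarrow> Y \<in> C \<Longrightarrow> X \<subseteq> Y \<or> Y \<subseteq> X"
      using C(2) by (auto simp: subset_chain_def)
    have cg: "char_graph X" if "X \<in> C" for X using sub that by blast
    obtain X0 where X0: "X0 \<in> C" using C(1) by blast
    have "char_graph (\<Union>C)"
      unfolding char_graph_def
    proof (intro conjI allI impI)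
      fix a show "(0, a) \<in> \<Union>C \<longleftrightarrow> a = 1"
      proof
        assume "(0, a) \<in> \<Union>C"
        then obtain X where "X \<in> C" "(0, a) \<in> X" by blast
        then show "a = 1" using char_graphD(2)[OF cg] by blast
      next
        assume "a = 1"
        then show "(0, a) \<in> \<Union>C" using char_graphD(1)[OF cg[OF X0]] X0 by blast
      qed
    next
      fix f a g b assume "(f, a) \<in> \<Union>C \<and> (g, b) \<in> \<Union>C"
      then obtain X Y where XY: "X \<in> C" "Y \<in> C" "(f, a) \<in> X" "(g, b) \<in> Y" by blast
      from lin[OF XY(1,2)] XY obtain Z where Z: "Z \<in> C" "(f, a) \<in> Z" "(g, b) \<in> Z" by blast
      from char_graphD(3)[OF cg[OF Z(1)] Z(2,3)] Z(1) show "(f + g, a * b) \<in> \<Union>C" by blast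
    next
      fix f a assume "(f, a) \<in> \<Union>C"
      then obtain Z where Z: "Z \<in> C" "(f, a) \<in> Z" by blast
      from char_graphD(4)[OF cg[OF Z(1)] Z(2)] Z(1) show "(- f, inverse a) \<in> \<Union>C" by blast
    qed
    then show ?thesis using sub X0 by blast
  qed
  moreover have "?A \<noteq> {}" using assms by auto
  ultimately have "\<exists>R\<in>?A. \<forall>X\<in>?A. R \<subseteq> X \<longrightarrow> X = R" by (intro subset_Zorn_nonempty) auto
  then obtain R where R: "R0 \<subseteq> R" "char_graph R"
    and max: "\<And>X. R0 \<subseteq> X \<Longrightarrow> char_graph X \<Longrightarrow> R \<subseteq> X \<Longrightarrow> X = R"
    by auto
  have total: "\<exists>a. (f, a) \<in> R" for f
  proof -
    define A where "A = {k. \<exists>c. (of_int k *s f, c) \<in> R}"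
    have "0 \<in> A" using char_graphD(1)[OF R(2)] by (auto simp: A_def)
    moreover have "k - l \<in> A" if "k \<in> A" "l \<in> A" for k l
    proof -
      from that obtain c e where "(of_int k *s f, c) \<in> R" "(of_int l *s f, e) \<in> R" by (auto simp: A_def)
      from char_graphD(3)[OF R(2) this(1) char_graphD(4)[OF R(2) this(2)]]
      show ?thesis by (auto simp: A_def Zx.scale_left_diff_distrib)
    qed
    ultimately obtain m where m: "A = {k. int m dvd k}" by (rule int_subgroup_principal)
    have "int m \<in> A" using m by simp
    then obtain c where c: "(of_int (int m) *s f, c) \<in> R" by (auto simp only: A_def mem_Collect_eq)
    have c0: "c \<noteq> 0" using char_graph_nonzero[OF R(2) c] .
    obtain d where d: "d ^ m = c" "d \<noteq> 0"
    proof (cases "m = 0")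
      case True
      then have "c = 1" using c char_graphD(2)[OF R(2)] by simp
      then show ?thesis using True that[of 1] by simp
    next
      case False
      then obtain d where "d ^ m = c" using nth_root_exists[of m c] by auto
      moreover have "d \<noteq> 0" using \<open>d ^ m = c\<close> c0 False by (auto simp: power_0_left)
      ultimately show ?thesis by (rule that)
    qed
    have compat: "e = d powi k" if e: "(of_int k *s f, e) \<in> R" for k e
    proof -
      have "k \<in> A" using e by (auto simp: A_def)
      then obtain q where q: "k = int m * q" using m by (auto simp: dvd_def)
      have "(of_int q *s (of_int (int m) *s f), c powi q) \<in> R"
        by (rule char_graph_multiple[OF R(2) c])
      then have "(of_int k *s f, c powi q) \<in> R" by (simp add: q mult.commute)
      then have "e = c powi q" using char_graph_unique[OF R(2) e] by blast
      also have "\<dots> = d powi k" using d by (simp add: q power_int_mult)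
      finally show ?thesis .
    qed
    let ?R = "{(h + of_int k *s f, a * d powi k) | h a k. (h, a) \<in> R}"
    have "R \<subseteq> ?R"
    proof
      fix z assume z: "z \<in> R"
      obtain h a where "z = (h, a)" by (cases z)
      then have "z = (h + of_int 0 *s f, a * d powi 0)" "(h, a) \<in> R" using z by simp_all
      then show "z \<in> ?R" by blast
    qed
    moreover have "char_graph ?R" using char_graph_adjoin[OF R(2) d(2) compat] .
    ultimately have "?R = R" using max[of ?R] R(1) by blast
    moreover have "(0 + of_int 1 *s f, 1 * d powi 1) \<in> ?R" using char_graphD(1)[OF R(2)] by blast
    ultimately have "(f, d) \<in> R" by simp
    then show ?thesis by blast
  qed
  define \<theta> where "\<theta> f = (THE a. (f, a) \<in> R)" for f
  have th: "\<theta> f = a \<longleftrightarrow> (f, a) \<in> R" for f a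
  proof -
    obtain b where b: "(f, b) \<in> R" using total by blast
    then have "\<theta> f = b" unfolding \<theta>_def using char_graph_unique[OF R(2)] by blast
    then show ?thesis using b char_graph_unique[OF R(2) b] by blast
  qed
  have "\<theta> (f + g) = \<theta> f * \<theta> g" for f g
    using char_graphD(3)[OF R(2), of f "\<theta> f" g "\<theta> g"] th by blast
  moreover have "\<theta> 0 = 1" using char_graphD(1)[OF R(2)] th by blast
  ultimately have "group_char \<theta>" by (simp add: group_char_def)
  then show ?thesis using that[of \<theta>] th R(1) by blast
qed

lemma Zx_latticeD:
  assumes "Zx_lattice L"
  shows "0 \<in> L" and "f \<in> L \<Longrightarrow> g \<in> L \<Longrightarrow> f + g \<in> L" and "f \<in> L \<Longrightarrow> p *s f \<in> L"
    and "f \<in> L \<Longrightarrow> - f \<in> L" and "f \<in> L \<Longrightarrow> g \<in> L \<Longrightarrow> f - g \<in> L"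
proof -
  have L: "Zx.subspace L" using assms by (simp add: Zx_lattice_def)
  show "0 \<in> L" "f \<in> L \<Longrightarrow> g \<in> L \<Longrightarrow> f + g \<in> L" "f \<in> L \<Longrightarrow> p *s f \<in> L"
    "f \<in> L \<Longrightarrow> - f \<in> L" "f \<in> L \<Longrightarrow> g \<in> L \<Longrightarrow> f - g \<in> L"
    using L by (auto intro: Zx.subspace_0 Zx.subspace_add Zx.subspace_scale Zx.subspace_neg Zx.subspace_diff)
qed

lemma group_char_extends:
  fixes \<rho> :: "int poly ^ 'n \<Rightarrow> 'a::alg_closed_field"
  assumes L: "Zx_lattice L" and nz: "\<And>f. f \<in> L \<Longrightarrow> \<rho> f \<noteq> 0"
    and add: "\<And>f g. f \<in> L \<Longrightarrow> g \<in> L \<Longrightarrow> \<rho> (f + g) = \<rho> f * \<rho> g"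
  obtains \<theta> where "group_char \<theta>" "\<And>f. f \<in> L \<Longrightarrow> \<theta> f = \<rho> f"
proof -
  note LD = Zx_latticeD[OF L]
  have zero: "\<rho> 0 = 1" using add[OF LD(1) LD(1)] nz[OF LD(1)] by simp
  have neg: "\<rho> (- f) = inverse (\<rho> f)" if "f \<in> L" for f
    using add[OF that LD(4)[OF that]] zero nz[OF that] by (simp add: field_simps)
  have "char_graph {(f, \<rho> f) | f. f \<in> L}"
    unfolding char_graph_def using zero neg add LD by auto
  then show ?thesis by (rule char_graph_extends) (rule that, assumption, blast)
qed

text \<open>
  A root of \<open>1 + X + \<dots> + X\<^sup>m\<^sup>-\<^sup>1\<close> differs from \<open>1\<close>, because the value at \<open>1\<close> is \<open>m \<noteq> 0\<close>.
  The exponent \<open>m = 0\<close> is included so that elements of infinite order need no separate treatment.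
\<close>

lemma nontrivial_root_of_unity:
  assumes "m \<noteq> 1"
  obtains d :: "'a::{alg_closed_field, field_char_0}" where "d \<noteq> 0" "d \<noteq> 1" "d ^ m = 1"
proof (cases "m = 0")
  case True
  then show ?thesis using that[of 2] by simp
next
  case False
  then have "m - 1 > 0" using assms by simp
  then obtain d :: 'a where d: "(\<Sum>k\<le>m - 1. 1 * d ^ k) = 0" using alg_closed[of "m - 1" "\<lambda>_. 1"] by auto
  have "{..m - 1} = {..<m}" using False by auto
  then have s: "(\<Sum>k<m. d ^ k) = 0" using d by simp
  have "d ^ m - 1 = (d - 1) * (\<Sum>k<m. d ^ k)" by (rule power_diff_1_eq)
  then have "d ^ m = 1" using s by simp
  moreover have "d \<noteq> 1" using s False by auto
  moreover have "d \<noteq> 0" using \<open>d ^ m = 1\<close> False by (auto simp: power_0_left)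
  ultimately show ?thesis using that by blast
qed

text \<open>
  Start from the trivial character of \<open>L\<close> and send \<open>f\<close> to some \<open>d \<noteq> 1\<close> with \<open>d\<^sup>m = 1\<close>, where
  \<open>m\<close> is the order of \<open>f\<close> modulo \<open>L\<close>, or \<open>0\<close> if that order is infinite.
\<close>

lemma group_char_separates:
  fixes L :: "(int poly ^ 'n) set"
  assumes L: "Zx_lattice L" and f: "f \<notin> L"
  obtains \<psi> :: "int poly ^ 'n \<Rightarrow> 'a::{alg_closed_field, field_char_0}"
  where "group_char \<psi>" "\<And>g. g \<in> L \<Longrightarrow> \<psi> g = 1" "\<psi> f \<noteq> 1"
proof -
  note LD = Zx_latticeD[OF L]
  define A where "A = {k. of_int k *s f \<in> L}"
  have "0 \<in> A" "\<And>k l. k \<in> A \<Longrightarrow> l \<in> A \<Longrightarrow> k - l \<in> A"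
    using LD by (auto simp: A_def Zx.scale_left_diff_distrib)
  then obtain m where m: "A = {k. int m dvd k}" by (rule int_subgroup_principal)
  have "1 \<notin> A" using f by (simp add: A_def)
  then have "m \<noteq> 1" using m by auto
  then obtain d :: 'a where d: "d \<noteq> 0" "d \<noteq> 1" "d ^ m = 1" by (rule nontrivial_root_of_unity)
  have R: "char_graph (L \<times> {1::'a})"
    unfolding char_graph_def using LD by auto
  have compat: "c = d powi k" if "(of_int k *s f, c) \<in> L \<times> {1}" for k c
  proof -
    have "k \<in> A" "c = 1" using that by (auto simp: A_def)
    then obtain q where "k = int m * q" using m by (auto simp: dvd_def)
    then show ?thesis using d \<open>c = 1\<close> by (simp add: power_int_mult)
  qed
  have "char_graph {(h + of_int k *s f, a * d powi k) | h a k. (h, a) \<in> L \<times> {1}}"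
    by (rule char_graph_adjoin[OF R d(1) compat])
  then obtain \<psi> where \<psi>: "group_char \<psi>"
    "\<And>g a. (g, a) \<in> {(h + of_int k *s f, a * d powi k) | h a k. (h, a) \<in> L \<times> {1}} \<Longrightarrow> \<psi> g = a"
    by (rule char_graph_extends) (rule that)
  have *: "\<psi> (h + of_int k *s f) = d powi k" if "h \<in> L" for h k
  proof (rule \<psi>(2))
    have "(h + of_int k *s f, d powi k) = (h + of_int k *s f, 1 * d powi k)" "(h, 1) \<in> L \<times> {1::'a}" using that by auto
    then show "(h + of_int k *s f, d powi k) \<in> {(h + of_int k *s f, a * d powi k) | h a k. (h, a) \<in> L \<times> {1}}" by blast
  qed
  show ?thesis
  proof (rule that[OF \<psi>(1)])
    show "\<psi> g = 1" if "g \<in> L" for g using *[OF that, of 0] by simp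
    show "\<psi> f \<noteq> 1" using *[OF LD(1), of 1] d by simp
  qed
qed

lemma group_charD:
  assumes "group_char \<theta>"
  shows "\<theta> 0 = 1" and "\<theta> (f + g) = \<theta> f * \<theta> g" and "\<theta> f \<noteq> 0"
    and "\<theta> (- f) = inverse (\<theta> f)" and "\<theta> (f - g) = \<theta> f / \<theta> g"
    and "\<theta> (of_nat m *s f) = \<theta> f ^ m"
proof -
  show z: "\<theta> 0 = 1" and add: "\<theta> (f + g) = \<theta> f * \<theta> g" for f g
    using assms by (auto simp: group_char_def)
  have i: "\<theta> f * \<theta> (- f) = 1" for f using add[of f "- f"] z by simp
  then show "\<theta> f \<noteq> 0" for f by (metis mult_zero_left zero_neq_one)
  show n: "\<theta> (- f) = inverse (\<theta> f)" for f using i[of f] by (metis inverse_unique)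
  show "\<theta> (f - g) = \<theta> f / \<theta> g" using add[of f "- g"] n by (simp add: divide_inverse)
  show "\<theta> (of_nat m *s f) = \<theta> f ^ m"
    by (induction m) (auto simp: z add Zx.scale_left_distrib)
qed

lemma group_char_mult: "group_char \<theta> \<Longrightarrow> group_char \<psi> \<Longrightarrow> group_char (\<lambda>f. \<theta> f * \<psi> f)"
  by (auto simp: group_char_def)

section \<open>Evaluation at characters\<close>

lemma laurent_induct [case_names zero add]:
  fixes p :: "('a::field, 'n::finite) laurent"
  assumes "P 0" and "\<And>p f c. P p \<Longrightarrow> P (p + lmonom c f)"
  shows "P p"
proof -
  have "P (\<Sum>f\<in>A. lmonom (Poly_Mapping.lookup p f) f)" if "finite A" for A
    using that
  proof induction
    case (insert f A)
    from assms(2)[OF insert.IH, of f "Poly_Mapping.lookup p f"] insert.hyps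
    show ?case by (simp add: add.commute)
  qed (simp add: assms(1))
  moreover have "p = (\<Sum>f\<in>Poly_Mapping.keys p. lmonom (Poly_Mapping.lookup p f) f)"
  proof (rule poly_mapping_eqI)
    fix k show "Poly_Mapping.lookup p k =
      Poly_Mapping.lookup (\<Sum>f\<in>Poly_Mapping.keys p. lmonom (Poly_Mapping.lookup p f) f) k"
      by (auto simp: lookup_sum lookup_single when_def in_keys_iff)
  qed
  ultimately show ?thesis by (metis finite_keys)
qed

definition char_eval :: "(int poly ^ 'n \<Rightarrow> 'a::field) \<Rightarrow> ('a, 'n::finite) laurent \<Rightarrow> 'a" where
  "char_eval \<theta> p = (\<Sum>f\<in>Poly_Mapping.keys p. Poly_Mapping.lookup p f * \<theta> f)"

lemma char_eval_superset:
  assumes "finite A" "Poly_Mapping.keys p \<subseteq> A"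
  shows "char_eval \<theta> p = (\<Sum>f\<in>A. Poly_Mapping.lookup p f * \<theta> f)"
  unfolding char_eval_def by (rule sum.mono_neutral_left) (use assms in \<open>auto simp: in_keys_iff\<close>)

lemma char_eval_single [simp]: "char_eval \<theta> (lmonom c f) = c * \<theta> f"
  by (subst char_eval_superset[where A = "{f}"]) auto

lemma char_eval_zero [simp]: "char_eval \<theta> 0 = 0"
  by (simp add: char_eval_def)

lemma char_eval_add: "char_eval \<theta> (p + q) = char_eval \<theta> p + char_eval \<theta> q"
proof -
  let ?A = "Poly_Mapping.keys p \<union> Poly_Mapping.keys q"
  show ?thesis
    using Poly_Mapping.keys_add[of p q]
    by (simp add: char_eval_superset[where A = ?A] lookup_add sum.distrib distrib_right)
qed

lemma char_eval_uminus: "char_eval \<theta> (- p) = - char_eval \<theta> p"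
  using char_eval_add[of \<theta> p "- p"] by (simp add: eq_neg_iff_add_eq_0 add.commute)

lemma char_eval_diff: "char_eval \<theta> (p - q) = char_eval \<theta> p - char_eval \<theta> q"
  using char_eval_add[of \<theta> p "- q"] by (simp add: char_eval_uminus)

lemma char_eval_mult:
  assumes \<theta>: "group_char \<theta>"
  shows "char_eval \<theta> (p * q) = char_eval \<theta> p * char_eval \<theta> q"
proof (induction p rule: laurent_induct)
  case (add p f c)
  have "char_eval \<theta> (lmonom c f * q) = c * \<theta> f * char_eval \<theta> q"
    by (induction q rule: laurent_induct)
      (simp_all add: distrib_left char_eval_add mult_single group_charD[OF \<theta>])
  with add show ?case by (simp add: distrib_right char_eval_add)
qed simp

lemma char_eval_one: "group_char \<theta> \<Longrightarrow> char_eval \<theta> 1 = 1"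
  by (simp flip: single_one add: group_charD)

lemma char_eval_prod: "group_char \<theta> \<Longrightarrow> char_eval \<theta> (\<Prod>i\<in>A. p i) = (\<Prod>i\<in>A. char_eval \<theta> (p i))"
  by (induction A rule: infinite_finite_induct) (simp_all add: char_eval_one char_eval_mult)

section \<open>The ideal of a character on a lattice\<close>

text \<open>
  The ideal of the restriction of \<open>\<theta>\<close> to \<open>L\<close>. With a character \<open>\<theta>\<close> of the whole group as
  parameter, the set of points is visibly nonempty.
\<close>

definition vanishing_ideal ::
    "(int poly ^ 'n) set \<Rightarrow> (int poly ^ 'n \<Rightarrow> 'a::field) \<Rightarrow> ('a, 'n::finite) laurent set" where
  "vanishing_ideal L \<theta> =
     {p. \<forall>\<theta>'. group_char \<theta>' \<and> (\<forall>f\<in>L. \<theta>' f = \<theta> f) \<longrightarrow> char_eval \<theta>' p = 0}"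

lemma vanishing_idealD:
  "p \<in> vanishing_ideal L \<theta> \<Longrightarrow> group_char \<theta>' \<Longrightarrow> (\<And>f. f \<in> L \<Longrightarrow> \<theta>' f = \<theta> f) \<Longrightarrow> char_eval \<theta>' p = 0"
  by (auto simp: vanishing_ideal_def)

lemma vanishing_ideal_zero: "0 \<in> vanishing_ideal L \<theta>"
  by (simp add: vanishing_ideal_def)

lemma vanishing_ideal_add:
  "p \<in> vanishing_ideal L \<theta> \<Longrightarrow> q \<in> vanishing_ideal L \<theta> \<Longrightarrow> p + q \<in> vanishing_ideal L \<theta>"
  by (simp add: vanishing_ideal_def char_eval_add)

lemma vanishing_ideal_diff:
  "p \<in> vanishing_ideal L \<theta> \<Longrightarrow> q \<in> vanishing_ideal L \<theta> \<Longrightarrow> p - q \<in> vanishing_ideal L \<theta>"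
  by (simp add: vanishing_ideal_def char_eval_diff)

lemma vanishing_ideal_mult: "p \<in> vanishing_ideal L \<theta> \<Longrightarrow> r * p \<in> vanishing_ideal L \<theta>"
  by (simp add: vanishing_ideal_def char_eval_mult)

lemma one_notin_vanishing_ideal: "group_char \<theta> \<Longrightarrow> 1 \<notin> vanishing_ideal L \<theta>"
  using vanishing_idealD[of 1 L \<theta> \<theta>] by (auto simp: char_eval_one)

lemma binomial_in_vanishing_ideal:
  assumes "f - g \<in> L"
  shows "lmonom c f - lmonom (c * \<theta> (f - g)) g \<in> vanishing_ideal L \<theta>"
proof -
  have "\<theta>' f = \<theta> (f - g) * \<theta>' g" if "group_char \<theta>'" "\<forall>f\<in>L. \<theta>' f = \<theta> f" for \<theta>'
    using group_charD(2)[OF that(1), of "f - g" g] that(2) assms by simp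
  then show ?thesis by (auto simp: vanishing_ideal_def char_eval_diff)
qed

text \<open>
  Dedekind's independence argument. Exponents that lie in different cosets of \<open>L\<close> are separated
  by characters \<open>\<psi>\<close> trivial on \<open>L\<close>, and twisting by \<open>\<psi>\<close> preserves the ideal. So if \<open>h\<close> had no
  partner in its coset, the combination of \<open>p\<close> and its twist that cancels the term at some other exponent \<open>k\<close>
  would yield a smaller element still containing \<open>h\<close>, and finally a single
  monomial, which does not vanish anywhere.
\<close>

lemma vanishing_ideal_coset_partner:
  fixes p :: "('a::{alg_closed_field, field_char_0}, 'n::finite) laurent"
  assumes L: "Zx_lattice L" and \<theta>: "group_char \<theta>"
    and "p \<in> vanishing_ideal L \<theta>" and "h \<in> Poly_Mapping.keys p"
  shows "\<exists>k \<in> Poly_Mapping.keys p. k \<noteq> h \<and> k - h \<in> L"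
  using assms(3,4)
proof (induction "card (Poly_Mapping.keys p)" arbitrary: p rule: less_induct)
  case less
  show ?case
  proof (cases "Poly_Mapping.keys p = {h}")
    case True
    then have "char_eval \<theta> p = Poly_Mapping.lookup p h * \<theta> h" by (simp add: char_eval_def)
    moreover have "char_eval \<theta> p = 0" using vanishing_idealD[OF less.prems(1) \<theta>] by simp
    ultimately show ?thesis using less.prems(2) group_charD(3)[OF \<theta>] by (auto simp: in_keys_iff)
  next
    case False
    with less.prems(2) obtain k where k: "k \<in> Poly_Mapping.keys p" "k \<noteq> h" by blast
    show ?thesis
    proof (cases "k - h \<in> L")
      case False
      then obtain \<psi> :: "int poly ^ 'n \<Rightarrow> 'a" where \<psi>: "group_char \<psi>" "\<And>g. g \<in> L \<Longrightarrow> \<psi> g = 1" "\<psi> (k - h) \<noteq> 1"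
        using group_char_separates[OF L, where 'a = 'a] by blast
      have neq: "\<psi> h - \<psi> k \<noteq> 0" using \<psi>(3) group_charD(3,5)[OF \<psi>(1)] by auto
      \<comment> \<open>The twist by \<open>\<psi>\<close> minus \<open>\<psi>(k)\<close> times \<open>p\<close>: the term at \<open>k\<close> cancels, the one at \<open>h\<close> survives.\<close>
      define p' where "p' = Poly_Mapping.mapp (\<lambda>f c. c * (\<psi> f - \<psi> k)) p"
      have lk: "Poly_Mapping.lookup p' f = Poly_Mapping.lookup p f * (\<psi> f - \<psi> k)" for f
        by (auto simp: p'_def lookup_mapp when_def in_keys_iff)
      have sub: "Poly_Mapping.keys p' \<subseteq> Poly_Mapping.keys p - {k}" by (auto simp: in_keys_iff lk)
      have h: "h \<in> Poly_Mapping.keys p'" using less.prems(2) neq by (simp add: in_keys_iff lk)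
      have "char_eval \<theta>' p' = 0" if \<theta>': "group_char \<theta>'" "\<forall>f\<in>L. \<theta>' f = \<theta> f" for \<theta>'
      proof -
        have "char_eval \<theta>' p' = (\<Sum>f\<in>Poly_Mapping.keys p. Poly_Mapping.lookup p' f * \<theta>' f)"
          by (rule char_eval_superset) (use sub in auto)
        also have "\<dots> = char_eval (\<lambda>f. \<theta>' f * \<psi> f) p - \<psi> k * char_eval \<theta>' p"
          by (simp add: lk char_eval_def sum_subtractf[symmetric] sum_distrib_left algebra_simps)
        also have "char_eval (\<lambda>f. \<theta>' f * \<psi> f) p = 0"
          using \<theta>' \<psi> by (intro vanishing_idealD[OF less.prems(1)] group_char_mult) auto
        also have "char_eval \<theta>' p = 0"
          using \<theta>' by (intro vanishing_idealD[OF less.prems(1)]) auto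
        finally show ?thesis by simp
      qed
      then have "p' \<in> vanishing_ideal L \<theta>" by (auto simp: vanishing_ideal_def)
      moreover have "card (Poly_Mapping.keys p') < card (Poly_Mapping.keys p)"
        by (rule psubset_card_mono) (use sub k in auto)
      ultimately show ?thesis using less.hyps[of p'] h sub by blast
    qed (use k in blast)
  qed
qed

text \<open>
  This is the case of the zero lattice, whose cosets are singletons. It allows identities of
  Laurent polynomials to be checked after evaluation, where they become identities in the field.
\<close>

lemma laurent_eq_zero_if_evals_zero:
  fixes p :: "('a::{alg_closed_field, field_char_0}, 'n::finite) laurent"
  assumes "\<And>\<theta>. group_char \<theta> \<Longrightarrow> char_eval \<theta> p = 0"
  shows "p = 0"
proof (rule ccontr)
  assume "p \<noteq> 0"
  then obtain h where h: "h \<in> Poly_Mapping.keys p"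
    by (metis in_keys_iff lookup_zero poly_mapping_eqI)
  have "Zx_lattice {0 :: int poly ^ 'n}" by (auto simp: Zx_lattice_iff)
  moreover have "group_char (\<lambda>_ :: int poly ^ 'n. 1 :: 'a)" by (simp add: group_char_def)
  moreover have "p \<in> vanishing_ideal {0} (\<lambda>_. 1)" using assms by (auto simp: vanishing_ideal_def)
  ultimately have "\<exists>k \<in> Poly_Mapping.keys p. k \<noteq> h \<and> k - h \<in> {0}"
    using h by (rule vanishing_ideal_coset_partner)
  then show False by simp
qed

text \<open>
  Subtracting a binomial moves the term at \<open>h\<close> to the exponent \<open>k\<close>, which is already present.
\<close>

lemma keys_collapse:
  fixes p :: "('a::field, 'n::finite) laurent"
  assumes "h \<in> Poly_Mapping.keys p" "k \<in> Poly_Mapping.keys p" "k \<noteq> h"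
  shows "Poly_Mapping.keys (p - (lmonom (Poly_Mapping.lookup p h) h - lmonom c k))
           \<subseteq> Poly_Mapping.keys p - {h}"
  using assms by (auto simp: in_keys_iff lookup_minus lookup_single when_def split: if_splits)

text \<open>
  As long as \<open>p \<noteq> 0\<close>, two of its exponents lie in one coset of \<open>L\<close>, and a multiple of a
  generator merges their terms; the number of terms drops until nothing is left.
\<close>

lemma vanishing_ideal_generated:
  fixes I :: "('a::{alg_closed_field, field_char_0}, 'n::finite) laurent set"
  assumes L: "Zx_lattice L" and \<theta>: "group_char \<theta>"
    and I: "0 \<in> I" "\<And>p q. p \<in> I \<Longrightarrow> q \<in> I \<Longrightarrow> p + q \<in> I" "\<And>r p. p \<in> I \<Longrightarrow> r * p \<in> I"
    and gen: "\<And>f. f \<in> L \<Longrightarrow> lmonom 1 f - lconst (\<theta> f) \<in> I"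
  shows "vanishing_ideal L \<theta> \<subseteq> I"
proof
  fix p assume "p \<in> vanishing_ideal L \<theta>"
  then show "p \<in> I"
  proof (induction "card (Poly_Mapping.keys p)" arbitrary: p rule: less_induct)
    case less
    show ?case
    proof (cases "p = 0")
      case False
      then obtain h where h: "h \<in> Poly_Mapping.keys p"
        by (metis in_keys_iff lookup_zero poly_mapping_eqI)
      with vanishing_ideal_coset_partner[OF L \<theta> less.prems] obtain k where
        k: "k \<in> Poly_Mapping.keys p" "k \<noteq> h" "k - h \<in> L" by blast
      have kh: "h - k \<in> L" using Zx_latticeD(4)[OF L k(3)] by simp
      define c where "c = Poly_Mapping.lookup p h"
      define b where "b = lmonom c h - lmonom (c * \<theta> (h - k)) k"
      have "b = lmonom c k * (lmonom 1 (h - k) - lconst (\<theta> (h - k)))"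
        by (simp add: b_def right_diff_distrib mult_single)
      then have bI: "b \<in> I" using I(3) gen[OF kh] by simp
      have sub: "Poly_Mapping.keys (p - b) \<subseteq> Poly_Mapping.keys p - {h}"
        unfolding b_def c_def by (rule keys_collapse) (use h k in auto)
      have "p - b \<in> I"
      proof (rule less.hyps)
        show "card (Poly_Mapping.keys (p - b)) < card (Poly_Mapping.keys p)"
          by (rule psubset_card_mono) (use sub h in auto)
        show "p - b \<in> vanishing_ideal L \<theta>"
          unfolding b_def using kh by (intro vanishing_ideal_diff less.prems binomial_in_vanishing_ideal)
      qed
      from I(2)[OF this bI] show ?thesis by simp
    qed (simp add: I(1))
  qed
qed

text \<open>
  Two exponents \<open>f\<close> and \<open>0\<close> can only be partners if \<open>f \<in> L\<close>; hence the lattice can be recovered from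
  the ideal.
\<close>

lemma vanishing_ideal_support:
  fixes \<theta> :: "int poly ^ 'n \<Rightarrow> 'a::{alg_closed_field, field_char_0}"
  assumes L: "Zx_lattice L" and \<theta>: "group_char \<theta>"
  shows "lmonom 1 f - lconst c \<in> vanishing_ideal L \<theta> \<longleftrightarrow> f \<in> L \<and> c = \<theta> f"
proof
  assume *: "lmonom 1 f - lconst c \<in> vanishing_ideal L \<theta>"
  then have "c = \<theta> f"
    using vanishing_idealD[OF * \<theta>] by (simp add: char_eval_diff group_charD[OF \<theta>])
  moreover have "f \<in> L"
  proof (cases "f = 0")
    case False
    then have "f \<in> Poly_Mapping.keys (lmonom 1 f - lconst c)"
      by (simp add: in_keys_iff lookup_minus lookup_single when_def)
    from vanishing_ideal_coset_partner[OF L \<theta> * this]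
    obtain k where "k \<in> Poly_Mapping.keys (lmonom 1 f - lconst c)" "k \<noteq> f" "k - f \<in> L" by blast
    then have "- f \<in> L"
      by (auto simp: in_keys_iff lookup_minus lookup_single when_def split: if_splits)
    then show ?thesis using Zx_latticeD(4)[OF L] by fastforce
  qed (simp add: Zx_latticeD(1)[OF L])
  ultimately show "f \<in> L \<and> c = \<theta> f" by simp
next
  assume "f \<in> L \<and> c = \<theta> f"
  then show "lmonom 1 f - lconst c \<in> vanishing_ideal L \<theta>"
    using binomial_in_vanishing_ideal[of f 0 L 1 \<theta>] by simp
qed

section \<open>Primality over torsion-free quotients\<close>

definition Z_saturated :: "(int poly ^ 'n) set \<Rightarrow> bool" where
  "Z_saturated S \<longleftrightarrow> (\<forall>m\<ge>1. \<forall>f. of_nat m *s f \<in> S \<longrightarrow> f \<in> S)"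

text \<open>
  A torsion-free abelian group carries a translation invariant total order. The order on the
  quotient by \<open>S\<close> is given by the preimage \<open>P\<close> of its nonnegative elements, so no quotient type is
  needed. A maximal cone is total: if neither \<open>f\<close> nor \<open>- f\<close> can be adjoined to \<open>P\<close>, then both
  \<open>- m f\<close> and \<open>l f\<close> lie in \<open>P\<close> for some positive \<open>m\<close> and \<open>l\<close>, so \<open>m l f\<close> lies in \<open>S\<close> and hence
  so does \<open>f\<close>.
\<close>

lemma total_cone:
  fixes S :: "(int poly ^ 'n) set"
  assumes S: "Zx_lattice S" and sat: "Z_saturated S"
  obtains P where "S \<subseteq> P" and "\<And>f g. f \<in> P \<Longrightarrow> g \<in> P \<Longrightarrow> f + g \<in> P"
    and "\<And>f. f \<in> P \<Longrightarrow> - f \<in> P \<Longrightarrow> f \<in> S" and "\<And>f. f \<in> P \<or> - f \<in> P"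
proof -
  note SD = Zx_latticeD[OF S]
  define cone where "cone P \<longleftrightarrow> S \<subseteq> P \<and> (\<forall>f\<in>P. \<forall>g\<in>P. f + g \<in> P) \<and> (\<forall>f\<in>P. - f \<in> P \<longrightarrow> f \<in> S)" for P
  have coneD: "S \<subseteq> P" "\<And>f g. f \<in> P \<Longrightarrow> g \<in> P \<Longrightarrow> f + g \<in> P" "\<And>f. f \<in> P \<Longrightarrow> - f \<in> P \<Longrightarrow> f \<in> S"
    if "cone P" for P using that by (auto simp: cone_def)
  have chain: "\<Union>C \<in> Collect cone" if C: "C \<noteq> {}" "subset.chain (Collect cone) C" for C
  proof -
    have cg: "\<And>X. X \<in> C \<Longrightarrow> cone X" and lin: "\<And>X Y. X \<in> C \<Longrightarrow> Y \<in> C \<Longrightarrow> X \<subseteq> Y \<or> Y \<subseteq> X"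
      using C(2) by (auto simp: subset_chain_def)
    have two: "\<exists>Z\<in>C. f \<in> Z \<and> g \<in> Z" if "f \<in> \<Union>C" "g \<in> \<Union>C" for f g
    proof -
      from that obtain X Y where XY: "X \<in> C" "Y \<in> C" "f \<in> X" "g \<in> Y" by blast
      from lin[OF XY(1,2)] XY show ?thesis by blast
    qed
    obtain X0 where "X0 \<in> C" using C(1) by blast
    then have "S \<subseteq> \<Union>C" using coneD(1)[OF cg] by blast
    moreover have "f + g \<in> \<Union>C" if "f \<in> \<Union>C" "g \<in> \<Union>C" for f g
      using two[OF that] coneD(2)[OF cg] by blast
    moreover have "f \<in> S" if "f \<in> \<Union>C" "- f \<in> \<Union>C" for f
      using two[OF that] coneD(3)[OF cg] by blast
    ultimately show ?thesis unfolding mem_Collect_eq cone_def by blast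
  qed
  have "cone S" using SD by (auto simp: cone_def)
  then have "Collect cone \<noteq> {}" by blast
  from subset_Zorn_nonempty[OF this chain]
  obtain P where P: "cone P" and max: "\<And>X. cone X \<Longrightarrow> P \<subseteq> X \<Longrightarrow> X = P" by auto
  note PD = coneD[OF P]
  have P0: "0 \<in> P" using PD(1) SD(1) by blast
  have mult: "of_nat m *s f \<in> P" if "f \<in> P" for m f
    by (induction m) (use that P0 PD(2) in \<open>auto simp: Zx.scale_left_distrib\<close>)
  \<comment> \<open>The cone generated by \<open>P\<close> and a missing \<open>f\<close> meets its negative outside \<open>S\<close>, by maximality.\<close>
  have key: "\<exists>m\<ge>1. - (of_nat m *s f) \<in> P" if f: "f \<notin> P" for f
  proof -
    let ?P = "{p + of_nat k *s f | p k. p \<in> P}"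
    have PsubP: "P \<subseteq> ?P"
    proof
      fix p assume "p \<in> P"
      moreover have "p = p + of_nat 0 *s f" by simp
      ultimately show "p \<in> ?P" by blast
    qed
    have "f = 0 + of_nat 1 *s f" by simp
    then have "f \<in> ?P" using P0 by blast
    then have "\<not> cone ?P" using max[OF _ PsubP] f by blast
    moreover have "S \<subseteq> ?P" using PD(1) PsubP by blast
    moreover have "g + h \<in> ?P" if "g \<in> ?P" "h \<in> ?P" for g h
    proof -
      from that obtain p k q l where *: "g = p + of_nat k *s f" "p \<in> P" "h = q + of_nat l *s f" "q \<in> P" by blast
      have "g + h = (p + q) + of_nat (k + l) *s f" by (simp add: * Zx.scale_left_distrib)
      then show ?thesis using PD(2)[OF *(2,4)] by blast
    qed
    ultimately obtain g where g: "g \<in> ?P" "- g \<in> ?P" "g \<notin> S" unfolding cone_def by blast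
    then obtain p k q l where *: "g = p + of_nat k *s f" "p \<in> P" "- g = q + of_nat l *s f" "q \<in> P" by blast
    have "(p + q) + of_nat (k + l) *s f = (p + of_nat k *s f) + (q + of_nat l *s f)"
      by (simp add: Zx.scale_left_distrib)
    also have "\<dots> = g + (- g)" by (simp only: *(1)[symmetric] *(3)[symmetric])
    finally have "(p + q) + of_nat (k + l) *s f = g + (- g)" .
    then have "of_nat (k + l) *s f + (p + q) = 0" by (simp only: add.commute right_minus)
    then have eq: "- (of_nat (k + l) *s f) = p + q" by (simp only: neg_eq_iff_add_eq_0)
    have "k + l \<ge> 1"
    proof (rule ccontr)
      assume "\<not> k + l \<ge> 1"
      then have "g = p" "- g = q" using * by auto
      then have "g \<in> S" using PD(3) * by blast
      with g show False by blast
    qed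
    moreover have "- (of_nat (k + l) *s f) \<in> P" using eq PD(2)[OF *(2,4)] by simp
    ultimately show ?thesis by blast
  qed
  have total: "f \<in> P \<or> - f \<in> P" for f
  proof (rule ccontr)
    assume "\<not> ?thesis"
    then obtain m l where m: "m \<ge> 1" "- (of_nat m *s f) \<in> P" and l: "l \<ge> 1" "- (of_nat l *s (- f)) \<in> P"
      using key[of f] key[of "- f"] by blast
    have "of_nat m *s (- (of_nat l *s (- f))) \<in> P" "of_nat l *s (- (of_nat m *s f)) \<in> P"
      using mult m l by blast+
    then have "of_nat (m * l) *s f \<in> P" "- (of_nat (m * l) *s f) \<in> P"
      by (simp_all add: Zx.scale_minus_right mult.commute)
    then have "of_nat (m * l) *s f \<in> S" by (rule PD(3))
    moreover have "m * l \<ge> 1" using m l by simp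
    ultimately have "f \<in> P" using sat PD(1) unfolding Z_saturated_def by blast
    with \<open>\<not> ?thesis\<close> show False by blast
  qed
  show ?thesis by (rule that[OF PD total])
qed

lemma cone_maximum:
  fixes P :: "'g::ab_group_add set"
  assumes "finite A" "A \<noteq> {}" and "0 \<in> P" and add: "\<And>f g. f \<in> P \<Longrightarrow> g \<in> P \<Longrightarrow> f + g \<in> P"
    and total: "\<And>f. f \<in> P \<or> - f \<in> P"
  shows "\<exists>m\<in>A. \<forall>f\<in>A. m - f \<in> P"
  using assms(1,2)
proof (induction rule: finite_ne_induct)
  case (singleton x)
  then show ?case using \<open>0 \<in> P\<close> by simp
next
  case (insert x A)
  then obtain m where m: "m \<in> A" "\<forall>f\<in>A. m - f \<in> P" by blast
  show ?case
  proof (cases "m - x \<in> P")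
    case True
    then show ?thesis using m by blast
  next
    case False
    then have xm: "x - m \<in> P" using total[of "m - x"] by simp
    have "x - f \<in> P" if "f \<in> A" for f
      using add[OF xm, of "m - f"] m that by simp
    then show ?thesis using \<open>0 \<in> P\<close> by auto
  qed
qed

text \<open>
  A normal form modulo the ideal: at most one exponent in each coset of \<open>S\<close>.
\<close>

lemma vanishing_ideal_reduced_representative:
  fixes p :: "('a::field, 'n::finite) laurent"
  obtains p' where "p - p' \<in> vanishing_ideal S \<theta>"
    "\<And>h k. h \<in> Poly_Mapping.keys p' \<Longrightarrow> k \<in> Poly_Mapping.keys p' \<Longrightarrow> h - k \<in> S \<Longrightarrow> h = k"
proof -
  have "\<exists>p'. p - p' \<in> vanishing_ideal S \<theta> \<and>
    (\<forall>h\<in>Poly_Mapping.keys p'. \<forall>k\<in>Poly_Mapping.keys p'. h - k \<in> S \<longrightarrow> h = k)"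
  proof (induction "card (Poly_Mapping.keys p)" arbitrary: p rule: less_induct)
    case less
    show ?case
    proof (cases "\<forall>h\<in>Poly_Mapping.keys p. \<forall>k\<in>Poly_Mapping.keys p. h - k \<in> S \<longrightarrow> h = k")
      case True
      then show ?thesis using vanishing_ideal_zero by (intro exI[of _ p]) simp
    next
      case False
      then obtain h k where hk: "h \<in> Poly_Mapping.keys p" "k \<in> Poly_Mapping.keys p" "h - k \<in> S" "h \<noteq> k" by blast
      define c where "c = Poly_Mapping.lookup p h"
      define b where "b = lmonom c h - lmonom (c * \<theta> (h - k)) k"
      have b: "b \<in> vanishing_ideal S \<theta>" unfolding b_def by (rule binomial_in_vanishing_ideal) fact
      have sub: "Poly_Mapping.keys (p - b) \<subseteq> Poly_Mapping.keys p - {h}"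
        unfolding b_def c_def by (rule keys_collapse) (use hk in auto)
      have "card (Poly_Mapping.keys (p - b)) < card (Poly_Mapping.keys p)"
        by (rule psubset_card_mono) (use sub hk in auto)
      from less.hyps[OF this] obtain p' where p': "p - b - p' \<in> vanishing_ideal S \<theta>"
        "\<forall>h\<in>Poly_Mapping.keys p'. \<forall>k\<in>Poly_Mapping.keys p'. h - k \<in> S \<longrightarrow> h = k" by blast
      have "p - p' \<in> vanishing_ideal S \<theta>"
        using vanishing_ideal_add[OF p'(1) b] by (simp add: algebra_simps)
      then show ?thesis using p'(2) by blast
    qed
  qed
  then show ?thesis using that by blast
qed

text \<open>
  In normal form both factors have a leading term for the order on the quotient by \<open>S\<close>. The
  product of the leading terms is the only contribution to its coset, so by
  \<open>vanishing_ideal_coset_partner\<close> the product of two elements outside the ideal is outside as well.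
\<close>

lemma vanishing_ideal_prime:
  fixes \<theta> :: "int poly ^ 'n \<Rightarrow> 'a::{alg_closed_field, field_char_0}"
  assumes S: "Zx_lattice S" and sat: "Z_saturated S"
    and \<theta>: "group_char \<theta>" and pq: "p * q \<in> vanishing_ideal S \<theta>"
  shows "p \<in> vanishing_ideal S \<theta> \<or> q \<in> vanishing_ideal S \<theta>"
proof (rule ccontr)
  assume "\<not> ?thesis"
  then have np: "p \<notin> vanishing_ideal S \<theta>" and nq: "q \<notin> vanishing_ideal S \<theta>" by auto
  obtain P where P: "S \<subseteq> P" "\<And>f g. f \<in> P \<Longrightarrow> g \<in> P \<Longrightarrow> f + g \<in> P"
    "\<And>f. f \<in> P \<Longrightarrow> - f \<in> P \<Longrightarrow> f \<in> S" "\<And>f. f \<in> P \<or> - f \<in> P"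
    by (rule total_cone[OF S sat]) (rule that)
  have P0: "0 \<in> P" using P(1) Zx_latticeD(1)[OF S] by blast
  obtain p' where p': "p - p' \<in> vanishing_ideal S \<theta>"
    and redp: "\<And>h k. h \<in> Poly_Mapping.keys p' \<Longrightarrow> k \<in> Poly_Mapping.keys p' \<Longrightarrow> h - k \<in> S \<Longrightarrow> h = k"
    by (rule vanishing_ideal_reduced_representative) (rule that)
  obtain q' where q': "q - q' \<in> vanishing_ideal S \<theta>"
    and redq: "\<And>h k. h \<in> Poly_Mapping.keys q' \<Longrightarrow> k \<in> Poly_Mapping.keys q' \<Longrightarrow> h - k \<in> S \<Longrightarrow> h = k"
    by (rule vanishing_ideal_reduced_representative) (rule that)
  have "p' \<noteq> 0" "q' \<noteq> 0" using p' q' np nq by auto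
  then have ne: "Poly_Mapping.keys p' \<noteq> {}" "Poly_Mapping.keys q' \<noteq> {}"
    by (metis empty_iff in_keys_iff lookup_zero poly_mapping_eqI)+
  obtain f0 where f0: "f0 \<in> Poly_Mapping.keys p'" "\<forall>f\<in>Poly_Mapping.keys p'. f0 - f \<in> P"
    using cone_maximum[OF finite_keys ne(1) P0 P(2,4)] by blast
  obtain g0 where g0: "g0 \<in> Poly_Mapping.keys q'" "\<forall>g\<in>Poly_Mapping.keys q'. g0 - g \<in> P"
    using cone_maximum[OF finite_keys ne(2) P0 P(2,4)] by blast
  \<comment> \<open>The leading exponents give the only pair whose sum lies in the coset of \<open>f0 + g0\<close>.\<close>
  have uniq: "f = f0 \<and> g = g0"
    if f: "f \<in> Poly_Mapping.keys p'" and g: "g \<in> Poly_Mapping.keys q'" and s: "(f + g) - (f0 + g0) \<in> S" for f g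
  proof -
    have "- (f0 - f) = ((f + g) - (f0 + g0)) + (g0 - g)" "- (g0 - g) = ((f + g) - (f0 + g0)) + (f0 - f)"
      by (simp_all add: algebra_simps)
    moreover have "(f + g) - (f0 + g0) \<in> P" "f0 - f \<in> P" "g0 - g \<in> P"
      using P(1) s f g f0 g0 by blast+
    ultimately have "- (f0 - f) \<in> P" "- (g0 - g) \<in> P" using P(2) by presburger+
    then have "f0 - f \<in> S" "g0 - g \<in> S" using P(3) \<open>f0 - f \<in> P\<close> \<open>g0 - g \<in> P\<close> by blast+
    then show ?thesis using redp[OF f0(1) f] redq[OF g0(1) g] by simp
  qed
  have "p * q - p' * q' = q * (p - p') + p' * (q - q')" by (simp add: algebra_simps)
  then have "p * q - p' * q' \<in> vanishing_ideal S \<theta>"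
    using p' q' by (simp add: vanishing_ideal_add vanishing_ideal_mult)
  from vanishing_ideal_diff[OF pq this] have V: "p' * q' \<in> vanishing_ideal S \<theta>" by simp
  define c d where "c = Poly_Mapping.lookup p' f0" and "d = Poly_Mapping.lookup q' g0"
  define p1 q1 where "p1 = p' - lmonom c f0" and "q1 = q' - lmonom d g0"
  have p1: "Poly_Mapping.keys p1 \<subseteq> Poly_Mapping.keys p' - {f0}"
    by (auto simp: p1_def c_def in_keys_iff lookup_minus lookup_single when_def split: if_splits)
  have q1: "Poly_Mapping.keys q1 \<subseteq> Poly_Mapping.keys q' - {g0}"
    by (auto simp: q1_def d_def in_keys_iff lookup_minus lookup_single when_def split: if_splits)
  have "p' * q' = lmonom c f0 * lmonom d g0 + lmonom c f0 * q1 + p1 * q'"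
    by (simp add: p1_def q1_def algebra_simps)
  moreover have "f0 + g0 \<notin> Poly_Mapping.keys (lmonom c f0 * q1)"
  proof
    assume "f0 + g0 \<in> Poly_Mapping.keys (lmonom c f0 * q1)"
    then obtain f g where *: "f0 + g0 = f + g" "f \<in> Poly_Mapping.keys (lmonom c f0)" "g \<in> Poly_Mapping.keys q1"
      using keys_mult[of "lmonom c f0" q1] by blast
    then have "f = f0" by (auto split: if_splits)
    then show False using * q1 by auto
  qed
  moreover have "f0 + g0 \<notin> Poly_Mapping.keys (p1 * q')"
  proof
    assume "f0 + g0 \<in> Poly_Mapping.keys (p1 * q')"
    then obtain f g where *: "f0 + g0 = f + g" "f \<in> Poly_Mapping.keys p1" "g \<in> Poly_Mapping.keys q'"
      using keys_mult[of p1 q'] by blast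
    then show False using uniq[of f g] p1 Zx_latticeD(1)[OF S] by auto
  qed
  ultimately have "Poly_Mapping.lookup (p' * q') (f0 + g0) = c * d"
    by (simp add: lookup_add mult_single in_keys_iff)
  moreover have "c * d \<noteq> 0" using f0 g0 by (auto simp: c_def d_def in_keys_iff)
  ultimately have "f0 + g0 \<in> Poly_Mapping.keys (p' * q')" by (simp add: in_keys_iff)
  from vanishing_ideal_coset_partner[OF S \<theta> V this]
  obtain k where k: "k \<in> Poly_Mapping.keys (p' * q')" "k \<noteq> f0 + g0" "k - (f0 + g0) \<in> S" by blast
  then obtain f g where "k = f + g" "f \<in> Poly_Mapping.keys p'" "g \<in> Poly_Mapping.keys q'"
    using keys_mult[of p' q'] by blast
  then show False using uniq[of f g] k by simp
qed

section \<open>The endomorphism and perfectness of vanishing ideals\<close>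

context sigma_field
begin

lemma sigma_zero [simp]: "\<sigma> 0 = 0"
  by (simp add: sigma_eq_0_iff)

lemma sigma_power: "\<sigma> (a ^ k) = \<sigma> a ^ k"
  by (induction k) (simp_all add: sigma_one sigma_mult)

lemma sigma_inverse: "\<sigma> (inverse a) = inverse (\<sigma> a)"
proof (cases "a = 0")
  case False
  then have "\<sigma> a * \<sigma> (inverse a) = 1" by (simp flip: sigma_mult add: sigma_one)
  then show ?thesis by (rule inverse_unique[symmetric])
qed simp

lemma laurent_sigma_zero [simp]: "laurent_sigma \<sigma> 0 = 0"
  by (simp add: laurent_sigma_def)

lemma laurent_sigma_diff: "laurent_sigma \<sigma> (p - q) = laurent_sigma \<sigma> p - laurent_sigma \<sigma> q"
  using laurent_sigma_add[of "p - q" q] by (simp add: algebra_simps)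

lemma laurent_sigma_mult: "laurent_sigma \<sigma> (p * q) = laurent_sigma \<sigma> p * laurent_sigma \<sigma> q"
proof (induction p rule: laurent_induct)
  case (add p f c)
  have "laurent_sigma \<sigma> (lmonom c f * q) = lmonom (\<sigma> c) (xvar *s f) * laurent_sigma \<sigma> q"
    by (induction q rule: laurent_induct)
      (simp_all add: distrib_left laurent_sigma_add mult_single laurent_sigma_lmonom sigma_mult
        Zx.scale_right_distrib)
  with add show ?case by (simp add: distrib_right laurent_sigma_add laurent_sigma_lmonom)
qed simp

text \<open>
  The endomorphism acts on points: evaluation of \<open>\<sigma>(p)\<close> at \<open>\<theta>\<close> is \<open>\<sigma>\<close> of the evaluation of \<open>p\<close>
  at the point \<open>\<theta>' = \<sigma>\<^sup>-\<^sup>1 \<circ> \<theta> \<circ> x\<close>.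
\<close>

lemma char_eval_laurent_sigma:
  assumes "\<And>f. \<sigma> (\<theta>' f) = \<theta> (xvar *s f)"
  shows "char_eval \<theta> (laurent_sigma \<sigma> p) = \<sigma> (char_eval \<theta>' p)"
  by (induction p rule: laurent_induct)
    (simp_all add: laurent_sigma_add laurent_sigma_lmonom char_eval_add sigma_add sigma_mult assms)

end

context inversive_sigma_field
begin

lemma sigma_inv: "\<sigma> (inv \<sigma> a) = a"
  using sigma_bij by (simp add: bij_is_surj surj_f_inv_f)

lemma inv_sigma_mult: "inv \<sigma> (a * b) = inv \<sigma> a * inv \<sigma> b"
  using bij_is_inj[OF sigma_bij] by (metis inv_f_f sigma_inv sigma_mult)

lemma inv_sigma_one: "inv \<sigma> 1 = 1"
  using bij_is_inj[OF sigma_bij] by (metis inv_f_f sigma_one)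

end

text \<open>
  The map \<open>\<theta>' \<mapsto> \<sigma>\<^sup>-\<^sup>1 \<circ> \<theta>' \<circ> x\<close> preserves the set of points, because \<open>\<theta>\<close> commutes with the
  action on \<open>L\<close>.
\<close>

lemma vanishing_ideal_sigma_closed:
  fixes \<theta> :: "int poly ^ 'n \<Rightarrow> 'a::{alg_closed_field, field_char_0}"
  assumes "inversive_sigma_field \<sigma>" and pc: "partial_character \<sigma> L \<theta>"
    and p: "p \<in> vanishing_ideal L \<theta>"
  shows "laurent_sigma \<sigma> p \<in> vanishing_ideal L \<theta>"
proof -
  interpret inversive_sigma_field \<sigma> by fact
  have L: "Zx_lattice L" and \<theta>_x: "\<And>f. f \<in> L \<Longrightarrow> \<theta> (xvar *s f) = \<sigma> (\<theta> f)"
    using pc by (auto simp: partial_character_def)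
  have "char_eval \<theta>' (laurent_sigma \<sigma> p) = 0"
    if \<theta>': "group_char \<theta>'" "\<forall>f\<in>L. \<theta>' f = \<theta> f" for \<theta>'
  proof -
    define \<theta>'' where "\<theta>'' f = inv \<sigma> (\<theta>' (xvar *s f))" for f
    have "group_char \<theta>''" using group_charD(1,2)[OF \<theta>'(1)]
      by (simp add: group_char_def \<theta>''_def inv_sigma_mult inv_sigma_one Zx.scale_right_distrib)
    moreover have "\<theta>'' f = \<theta> f" if "f \<in> L" for f
      using that \<theta>'(2) \<theta>_x[OF that] Zx_latticeD(3)[OF L that] bij_is_inj[OF sigma_bij]
      by (simp add: \<theta>''_def)
    ultimately have "char_eval \<theta>'' p = 0" using vanishing_idealD[OF p] by blast
    moreover have "char_eval \<theta>' (laurent_sigma \<sigma> p) = \<sigma> (char_eval \<theta>'' p)"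
      by (rule char_eval_laurent_sigma) (simp add: \<theta>''_def sigma_inv)
    ultimately show ?thesis by simp
  qed
  then show ?thesis by (auto simp: vanishing_ideal_def)
qed

text \<open>
  For an \<open>x\<close>-saturated lattice the map \<open>\<theta>'' \<mapsto> \<sigma>\<^sup>-\<^sup>1 \<circ> \<theta>'' \<circ> x\<close> on points is onto. A preimage of \<open>\<theta>'\<close>
  must send \<open>x f + s\<close> with \<open>s \<in> S\<close> to \<open>\<sigma>(\<theta>'(f)) \<theta>(s)\<close>; saturation makes this well defined, and it
  extends to the whole group.
\<close>

lemma vanishing_ideal_reflexive:
  fixes \<theta> :: "int poly ^ 'n \<Rightarrow> 'a::{alg_closed_field, field_char_0}"
  assumes "sigma_field \<sigma>" and pc: "partial_character \<sigma> S \<theta>"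
    and xsat: "x_saturated S" and \<theta>: "group_char \<theta>"
    and p: "laurent_sigma \<sigma> p \<in> vanishing_ideal S \<theta>"
  shows "p \<in> vanishing_ideal S \<theta>"
proof -
  interpret sigma_field \<sigma> by fact
  have S: "Zx_lattice S" and \<theta>_x: "\<And>f. f \<in> S \<Longrightarrow> \<theta> (xvar *s f) = \<sigma> (\<theta> f)"
    using pc by (auto simp: partial_character_def)
  note SD = Zx_latticeD[OF S] and \<theta>D = group_charD[OF \<theta>]
  have "char_eval \<theta>' p = 0"
    if \<theta>': "group_char \<theta>'" "\<forall>f\<in>S. \<theta>' f = \<theta> f" for \<theta>'
  proof -
    note \<theta>'D = group_charD[OF \<theta>'(1)]
    \<comment> \<open>The graph of the prescribed character on the subgroup of the elements \<open>x f + s\<close>.\<close>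
    let ?R = "{(xvar *s f + s, \<sigma> (\<theta>' f) * \<theta> s) | f s. s \<in> S}"
    have "char_graph ?R"
      unfolding char_graph_def
    proof (intro conjI allI impI)
      fix a show "(0, a) \<in> ?R \<longleftrightarrow> a = 1"
      proof
        assume "(0, a) \<in> ?R"
        then obtain f s where *: "xvar *s f + s = 0" "a = \<sigma> (\<theta>' f) * \<theta> s" "s \<in> S" by auto
        have eq: "xvar *s f = - s" using *(1) by (simp add: eq_neg_iff_add_eq_0)
        then have f: "f \<in> S" using xsat SD(4)[OF *(3)] by (simp add: x_saturated_def)
        have "\<sigma> (\<theta>' f) = \<theta> (- s)" using \<theta>_x[OF f] \<theta>'(2) f eq by simp
        then show "a = 1" using * \<theta>D by simp
      next
        assume "a = 1"
        then have "(0, a) = (xvar *s 0 + 0, \<sigma> (\<theta>' 0) * \<theta> 0)"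
          using \<theta>D(1) \<theta>'D(1) sigma_one by simp
        then show "(0, a) \<in> ?R" using SD(1) by blast
      qed
    next
      fix f a g b assume "(f, a) \<in> ?R \<and> (g, b) \<in> ?R"
      then obtain f1 s1 f2 s2 where *: "f = xvar *s f1 + s1" "a = \<sigma> (\<theta>' f1) * \<theta> s1" "s1 \<in> S"
        "g = xvar *s f2 + s2" "b = \<sigma> (\<theta>' f2) * \<theta> s2" "s2 \<in> S" by blast
      have "(f + g, a * b) = (xvar *s (f1 + f2) + (s1 + s2), \<sigma> (\<theta>' (f1 + f2)) * \<theta> (s1 + s2))"
        unfolding * by (simp add: Zx.scale_right_distrib \<theta>D \<theta>'D sigma_mult algebra_simps)
      then show "(f + g, a * b) \<in> ?R" using SD(2)[OF *(3,6)] by blast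
    next
      fix f a assume "(f, a) \<in> ?R"
      then obtain f1 s1 where *: "f = xvar *s f1 + s1" "a = \<sigma> (\<theta>' f1) * \<theta> s1" "s1 \<in> S" by blast
      have "(- f, inverse a) = (xvar *s (- f1) + (- s1), \<sigma> (\<theta>' (- f1)) * \<theta> (- s1))"
        unfolding * by (simp add: Zx.scale_minus_right \<theta>D \<theta>'D sigma_inverse)
      then show "(- f, inverse a) \<in> ?R" using SD(4)[OF *(3)] by blast
    qed
    then obtain \<theta>'' where \<theta>'': "group_char \<theta>''" and R: "\<And>f a. (f, a) \<in> ?R \<Longrightarrow> \<theta>'' f = a"
      by (rule char_graph_extends) (rule that)
    have ext: "\<theta>'' (xvar *s f + s) = \<sigma> (\<theta>' f) * \<theta> s" if "s \<in> S" for f s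
      by (rule R) (use that in blast)
    have "\<theta>'' s = \<theta> s" if "s \<in> S" for s
      using ext[OF that, of 0] \<theta>'D(1) sigma_one by simp
    then have "char_eval \<theta>'' (laurent_sigma \<sigma> p) = 0" using vanishing_idealD[OF p \<theta>''] by blast
    moreover have "char_eval \<theta>'' (laurent_sigma \<sigma> p) = \<sigma> (char_eval \<theta>' p)"
      by (rule char_eval_laurent_sigma) (use ext[OF SD(1)] \<theta>D(1) in simp)
    ultimately show ?thesis by (simp add: sigma_eq_0_iff)
  qed
  then show ?thesis by (auto simp: vanishing_ideal_def)
qed

lemma vanishing_ideal_sigma_ideal:
  fixes \<theta> :: "int poly ^ 'n \<Rightarrow> 'a::{alg_closed_field, field_char_0}"
  assumes "inversive_sigma_field \<sigma>" and "partial_character \<sigma> L \<theta>"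
  shows "sigma_ideal \<sigma> (vanishing_ideal L \<theta>)"
  unfolding sigma_ideal_iff
  using vanishing_ideal_zero vanishing_ideal_add vanishing_ideal_mult vanishing_ideal_sigma_closed[OF assms]
  by blast

text \<open>
  In a proper prime ideal a product of transforms of \<open>p\<close> forces some \<open>\<sigma>\<^sup>i(p)\<close> into the ideal, and
  reflexivity removes the exponent \<open>i\<close>.
\<close>

lemma vanishing_ideal_perfect:
  fixes \<theta> :: "int poly ^ 'n \<Rightarrow> 'a::{alg_closed_field, field_char_0}"
  assumes \<sigma>: "inversive_sigma_field \<sigma>" and pc: "partial_character \<sigma> S \<theta>"
    and sat: "Z_saturated S" and xsat: "x_saturated S" and \<theta>: "group_char \<theta>"
  shows "perfect_sigma_ideal \<sigma> (vanishing_ideal S \<theta>)"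
  unfolding perfect_sigma_ideal_def
proof (intro conjI allI impI)
  show "sigma_ideal \<sigma> (vanishing_ideal S \<theta>)"
    using \<sigma> pc by (rule vanishing_ideal_sigma_ideal)
  fix p a assume a: "a \<noteq> 0 \<and> sigma_power \<sigma> p a \<in> vanishing_ideal S \<theta>"
  let ?V = "vanishing_ideal S \<theta>"
  have S: "Zx_lattice S" using pc by (simp add: partial_character_def)
  have prime: "u \<in> ?V \<or> v \<in> ?V" if "u * v \<in> ?V" for u v
    by (rule vanishing_ideal_prime[OF S sat \<theta> that])
  have one: "1 \<notin> ?V" by (rule one_notin_vanishing_ideal[OF \<theta>])
  have power: "u \<in> ?V" if "u ^ k \<in> ?V" for u k
    using that by (induction k) (use prime one in auto)
  have prod: "\<exists>i\<in>A. u i \<in> ?V" if "finite A" "(\<Prod>i\<in>A. u i) \<in> ?V" for A :: "nat set" and u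
    using that by (induction A) (use prime one in auto)
  then obtain i where "(laurent_sigma \<sigma> ^^ i) p ^ poly.coeff a i \<in> ?V"
    using a prod[OF finite_atMost] unfolding sigma_power_def by blast
  then have "(laurent_sigma \<sigma> ^^ i) p \<in> ?V" by (rule power)
  then show "p \<in> ?V"
  proof (induction i)
    case (Suc i)
    have sf: "sigma_field \<sigma>" using \<sigma> by (simp add: inversive_sigma_field_def)
    have "laurent_sigma \<sigma> ((laurent_sigma \<sigma> ^^ i) p) \<in> ?V" using Suc.prems by simp
    from Suc.IH[OF vanishing_ideal_reflexive[OF sf pc xsat \<theta> this]] show ?case .
  qed simp
qed

section \<open>Perfect ideals and their colon ideals\<close>

lemma sigma_idealD:
  assumes "sigma_ideal \<sigma> I"
  shows "0 \<in> I" and "p \<in> I \<Longrightarrow> q \<in> I \<Longrightarrow> p + q \<in> I" and "p \<in> I \<Longrightarrow> r * p \<in> I"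
    and "p \<in> I \<Longrightarrow> laurent_sigma \<sigma> p \<in> I" and "p \<in> I \<Longrightarrow> q \<in> I \<Longrightarrow> p - q \<in> I"
proof -
  show *: "0 \<in> I" "\<And>p q. p \<in> I \<Longrightarrow> q \<in> I \<Longrightarrow> p + q \<in> I" "\<And>r p. p \<in> I \<Longrightarrow> r * p \<in> I"
    "p \<in> I \<Longrightarrow> laurent_sigma \<sigma> p \<in> I"
    using assms unfolding sigma_ideal_iff by blast+
  show "p - q \<in> I" if "p \<in> I" "q \<in> I" using *(2)[OF that(1) *(3)[OF that(2), of "- 1"]] by simp
qed

lemma perfect_sigma_idealD:
  assumes "perfect_sigma_ideal \<sigma> I"
  shows "sigma_ideal \<sigma> I" and "a \<noteq> 0 \<Longrightarrow> sigma_power \<sigma> p a \<in> I \<Longrightarrow> p \<in> I"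
  using assms unfolding perfect_sigma_ideal_def by blast+

lemma perfect_sigma_ideal_square:
  assumes "perfect_sigma_ideal \<sigma> I" and "p * p \<in> I" shows "p \<in> I"
proof (rule perfect_sigma_idealD(2)[OF assms(1)])
  show "[:2:] \<noteq> (0 :: nat poly)" by simp
  show "sigma_power \<sigma> p [:2:] \<in> I" using assms(2) by (simp add: sigma_power_def power2_eq_square)
qed

lemma perfect_sigma_ideal_reflexive:
  assumes "perfect_sigma_ideal \<sigma> I" and "laurent_sigma \<sigma> p \<in> I" shows "p \<in> I"
proof (rule perfect_sigma_idealD(2)[OF assms(1)])
  show "[:0, 1:] \<noteq> (0 :: nat poly)" by simp
  show "sigma_power \<sigma> p [:0, 1:] \<in> I" using assms(2) by (simp add: sigma_power_def)
qed

context sigma_field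
begin

text \<open>
  The element \<open>p \<sigma>(q)\<close> times its own transform is a multiple of \<open>\<sigma>(p q)\<close>; this is the exponent
  \<open>1 + x\<close> in the definition of perfect ideals.
\<close>

lemma perfect_sigma_ideal_mult_sigma:
  assumes I: "perfect_sigma_ideal \<sigma> I" and "p * q \<in> I"
  shows "p * laurent_sigma \<sigma> q \<in> I"
proof (rule perfect_sigma_idealD(2)[OF I])
  let ?s = "laurent_sigma \<sigma>"
  show "[:1, 1:] \<noteq> (0 :: nat poly)" by simp
  have "sigma_power \<sigma> (p * ?s q) [:1, 1:] = (p * ?s (?s q)) * ?s (p * q)"
    by (simp add: sigma_power_def laurent_sigma_mult algebra_simps)
  then show "sigma_power \<sigma> (p * ?s q) [:1, 1:] \<in> I"
    using sigma_idealD[OF perfect_sigma_idealD(1)[OF I]] assms(2) by simp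
qed

lemma perfect_sigma_ideal_mult_sigma_iter:
  assumes "perfect_sigma_ideal \<sigma> I" and "p * q \<in> I"
  shows "p * (laurent_sigma \<sigma> ^^ i) q \<in> I"
  by (induction i) (use assms perfect_sigma_ideal_mult_sigma in auto)

lemma laurent_sigma_iter_mult:
  "(laurent_sigma \<sigma> ^^ i) (p * q) = (laurent_sigma \<sigma> ^^ i) p * (laurent_sigma \<sigma> ^^ i) q"
  by (induction i) (simp_all add: laurent_sigma_mult)

text \<open>
  Colon ideals replace prime decompositions of perfect ideals: a statement that holds modulo each
  factor of a product can be passed on from the product to the ideal itself. If \<open>p\<^sup>a s \<in> I\<close>, then
  \<open>p\<^sup>a \<sigma>\<^sup>i(s) \<in> I\<close> for every \<open>i\<close>, and \<open>(p s)\<^sup>a\<close> is a multiple of such an element.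
\<close>

lemma perfect_sigma_ideal_colon:
  assumes I: "perfect_sigma_ideal \<sigma> I"
  shows "perfect_sigma_ideal \<sigma> {p. p * s \<in> I}"
  unfolding perfect_sigma_ideal_def
proof (intro conjI allI impI)
  note ID = sigma_idealD[OF perfect_sigma_idealD(1)[OF I]]
  show "sigma_ideal \<sigma> {p. p * s \<in> I}"
    unfolding sigma_ideal_iff
  proof (intro conjI ballI allI)
    show "0 \<in> {p. p * s \<in> I}" using ID(1) by simp
    show "p + q \<in> {p. p * s \<in> I}" if "p \<in> {p. p * s \<in> I}" "q \<in> {p. p * s \<in> I}" for p q
      using that ID(2) by (simp add: distrib_right)
    show "r * p \<in> {p. p * s \<in> I}" if "p \<in> {p. p * s \<in> I}" for r p
      using that ID(3)[of "p * s" r] by (simp add: mult.assoc)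
    show "laurent_sigma \<sigma> p \<in> {p. p * s \<in> I}" if "p \<in> {p. p * s \<in> I}" for p
      using that perfect_sigma_ideal_mult_sigma[OF I, of s p] by (simp add: mult.commute)
  qed
  fix p a assume "a \<noteq> 0 \<and> sigma_power \<sigma> p a \<in> {p. p * s \<in> I}"
  then have a: "a \<noteq> 0" and q: "sigma_power \<sigma> p a * s \<in> I" by auto
  have "(laurent_sigma \<sigma> ^^ degree a) s dvd (laurent_sigma \<sigma> ^^ degree a) s ^ coeff a (degree a)"
    using a by (intro dvd_power) (simp add: leading_coeff_0_iff flip: neq0_conv)
  also have "\<dots> dvd sigma_power \<sigma> s a"
    unfolding sigma_power_def by (rule dvd_prodI) auto
  finally obtain r where r: "sigma_power \<sigma> s a = (laurent_sigma \<sigma> ^^ degree a) s * r" ..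
  have "sigma_power \<sigma> (p * s) a = sigma_power \<sigma> p a * sigma_power \<sigma> s a"
    by (simp add: sigma_power_def laurent_sigma_iter_mult power_mult_distrib prod.distrib)
  also have "\<dots> = r * (sigma_power \<sigma> p a * (laurent_sigma \<sigma> ^^ degree a) s)"
    by (simp add: r algebra_simps)
  also have "\<dots> \<in> I" by (intro ID(3) perfect_sigma_ideal_mult_sigma_iter[OF I q])
  finally have "p * s \<in> I" by (rule perfect_sigma_idealD(2)[OF I a])
  then show "p \<in> {p. p * s \<in> I}" by simp
qed

text \<open>
  Perfect ideals containing a product behave like intersections over its factors. With \<open>s\<close> the
  product of the remaining factors, \<open>g\<close> lies in the colon ideal of \<open>s\<close>; then \<open>s\<close> lies in the colon
  ideal of \<open>g\<close>, so by induction \<open>g\<^sup>2 \<in> I\<close>.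
\<close>

lemma perfect_sigma_ideal_split:
  assumes "finite A" and "perfect_sigma_ideal \<sigma> I" and "(\<Prod>i\<in>A. u i) \<in> I"
    and "\<And>i I. i \<in> A \<Longrightarrow> perfect_sigma_ideal \<sigma> I \<Longrightarrow> u i \<in> I \<Longrightarrow> g \<in> I"
  shows "g \<in> I"
  using assms
proof (induction A arbitrary: I)
  case empty
  from sigma_idealD(3)[OF perfect_sigma_idealD(1)[OF empty(1)] empty(2), of g] show ?case by simp
next
  case (insert i A)
  let ?s = "\<Prod>i\<in>A. u i"
  have "u i \<in> {p. p * ?s \<in> I}" using insert.prems(2) insert.hyps by simp
  then have "g \<in> {p. p * ?s \<in> I}"
    by (rule insert.prems(3)[OF insertI1 perfect_sigma_ideal_colon[OF insert.prems(1)]])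
  then have "?s \<in> {p. p * g \<in> I}" by (simp add: mult.commute)
  then have "g \<in> {p. p * g \<in> I}"
    by (rule insert.IH[OF perfect_sigma_ideal_colon[OF insert.prems(1)]])
      (erule insert.prems(3)[OF insertI2], assumption+)
  then have "g * g \<in> I" by simp
  then show ?case by (rule perfect_sigma_ideal_square[OF insert.prems(1)])
qed

end

section \<open>Splitting binomials at roots of unity\<close>

lemma primitive_root_inj:
  assumes "primitive_root_of_unity m z" shows "inj_on (\<lambda>i. z ^ i) {..<m}"
proof -
  have z0: "z \<noteq> 0" and prim: "\<And>k. 0 < k \<Longrightarrow> k < m \<Longrightarrow> z ^ k \<noteq> 1"
    using assms by (auto simp: primitive_root_of_unity_def zero_power)
  have le: "j = k" if "j \<le> k" "k < m" "z ^ j = z ^ k" for j k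
  proof -
    have "z ^ k = z ^ j * z ^ (k - j)" using that(1) by (simp flip: power_add)
    then have "z ^ (k - j) = 1" using that(3) z0 by simp
    then show ?thesis using prim[of "k - j"] that by fastforce
  qed
  show ?thesis
  proof (rule inj_onI)
    fix j k assume "j \<in> {..<m}" "k \<in> {..<m}" "z ^ j = z ^ k"
    then show "j = k" using le[of j k] le[of k j] by (cases "j \<le> k") auto
  qed
qed

text \<open>
  Both sides are monic of degree \<open>m\<close> in \<open>x\<close> and vanish at the \<open>m\<close> distinct elements \<open>d z\<^sup>i\<close>.
\<close>

lemma power_diff_factorization:
  fixes x :: "'a::field"
  assumes z: "primitive_root_of_unity m z" and d: "d \<noteq> 0"
  shows "(\<Prod>i<m. x - d * z ^ i) = x ^ m - d ^ m"
proof -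
  define p where "p = (\<Prod>i<m. [:- (d * z ^ i), 1:])"
  define q where "q = monom 1 m - [:d ^ m:]"
  have m: "m > 0" and zm: "z ^ m = 1" using z by (auto simp: primitive_root_of_unity_def)
  let ?A = "(\<lambda>i. d * z ^ i) ` {..<m}"
  have inj: "inj_on (\<lambda>i. d * z ^ i) {..<m}"
    using primitive_root_inj[OF z] d by (auto simp: inj_on_def)
  have degp: "degree p = m" unfolding p_def by (subst degree_prod_eq_sum_degree) auto
  have "lead_coeff p = 1" unfolding p_def by (simp add: lead_coeff_prod)
  then have cp: "coeff p m = 1" by (simp add: degp)
  have "p = q"
  proof (rule poly_eqI_degree_lead_coeff[where n = m and A = ?A])
    show "coeff p m = coeff q m" using m by (simp add: cp q_def coeff_pCons split: nat.split)
    show "m \<le> card ?A" using card_image[OF inj] by simp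
    show "degree p \<le> m" by (simp add: degp)
    show "degree q \<le> m" unfolding q_def by (rule degree_diff_le) (auto simp: degree_monom_le)
    show "poly p w = poly q w" if "w \<in> ?A" for w
    proof -
      from that obtain i where i: "i < m" "w = d * z ^ i" by auto
      then have "poly p w = 0" unfolding p_def poly_prod by (intro prod_zero) auto
      moreover have "(z ^ i) ^ m = 1" by (metis mult.commute power_mult power_one zm)
      then have "poly q w = 0" by (simp add: q_def i poly_monom power_mult_distrib)
      ultimately show ?thesis by simp
    qed
  qed
  then have "poly p x = poly q x" by simp
  then show ?thesis by (simp add: p_def q_def poly_prod poly_monom)
qed

lemma binomial_factorization:
  fixes f :: "int poly ^ 'n" and d :: "'a::{alg_closed_field, field_char_0}"
  assumes z: "primitive_root_of_unity m z" and d: "d \<noteq> 0"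
  shows "lmonom 1 (of_nat m *s f) - lconst (d ^ m) = (\<Prod>i<m. lmonom 1 f - lconst (d * z ^ i))"
proof -
  have "lmonom 1 (of_nat m *s f) - lconst (d ^ m) - (\<Prod>i<m. lmonom 1 f - lconst (d * z ^ i)) = 0"
  proof (rule laurent_eq_zero_if_evals_zero)
    fix \<theta> :: "int poly ^ 'n \<Rightarrow> 'a" assume \<theta>: "group_char \<theta>"
    show "char_eval \<theta> (lmonom 1 (of_nat m *s f) - lconst (d ^ m)
        - (\<Prod>i<m. lmonom 1 f - lconst (d * z ^ i))) = 0"
      using power_diff_factorization[OF z d, of "\<theta> f"]
      by (simp add: char_eval_diff char_eval_prod[OF \<theta>] group_charD[OF \<theta>])
  qed
  then show ?thesis by simp
qed

section \<open>Support lattices\<close>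

context
  fixes I :: "('a::field, 'n::finite) laurent set" and \<sigma>
  assumes I: "sigma_ideal \<sigma> I"
begin

lemma binomial_add:
  assumes "lmonom 1 f - lconst c \<in> I" "lmonom 1 g - lconst d \<in> I"
  shows "lmonom 1 (f + g) - lconst (c * d) \<in> I"
proof -
  have "lmonom 1 (f + g) - lconst (c * d) =
    lmonom 1 f * (lmonom 1 g - lconst d) + lconst d * (lmonom 1 f - lconst c)"
    by (simp add: right_diff_distrib mult_single mult.commute)
  then show ?thesis using sigma_idealD[OF I] assms by simp
qed

lemma binomial_neg:
  assumes "lmonom 1 f - lconst c \<in> I" "c \<noteq> 0"
  shows "lmonom 1 (- f) - lconst (inverse c) \<in> I"
proof -
  have "lmonom 1 (- f) - lconst (inverse c) =
    lmonom (- inverse c) (- f) * (lmonom 1 f - lconst c)"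
    using assms(2) by (simp add: right_diff_distrib mult_single single_uminus)
  then show ?thesis using sigma_idealD[OF I] assms by simp
qed

lemma binomial_zero: "lmonom 1 0 - lconst 1 \<in> I"
  using sigma_idealD(1)[OF I] by simp

lemma binomial_of_nat:
  assumes "lmonom 1 f - lconst c \<in> I"
  shows "lmonom 1 (of_nat m *s f) - lconst (c ^ m) \<in> I"
proof (induction m)
  case (Suc m)
  then show ?case using binomial_add[OF assms] by (simp add: Zx.scale_left_distrib)
qed (use binomial_zero in simp)

text \<open>
  Two constants for one exponent would put a unit into \<open>I\<close>.
\<close>

lemma binomial_unique:
  assumes "1 \<notin> I" "lmonom 1 f - lconst c \<in> I" "lmonom 1 f - lconst d \<in> I"
  shows "c = d"
proof (rule ccontr)
  assume "c \<noteq> d"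
  have "lconst (d - c) = (lmonom 1 f - lconst c) - (lmonom 1 f - lconst d)"
    by (simp add: single_diff)
  then have "lconst (d - c) \<in> I" using sigma_idealD(5)[OF I assms(2,3)] by simp
  then have "lconst (inverse (d - c)) * lconst (d - c) \<in> I" by (rule sigma_idealD(3)[OF I])
  moreover have "lconst (inverse (d - c)) * lconst (d - c) = (1 :: ('a, 'n) laurent)"
    using \<open>c \<noteq> d\<close> by (simp add: mult_single)
  ultimately show False using assms(1) by simp
qed

lemma binomial_sigma:
  assumes "sigma_field \<sigma>" "lmonom 1 f - lconst c \<in> I"
  shows "lmonom 1 (xvar *s f) - lconst (\<sigma> c) \<in> I"
proof -
  interpret sigma_field \<sigma> by fact
  show ?thesis using sigma_idealD(4)[OF I assms(2)]
    by (simp add: laurent_sigma_diff laurent_sigma_lmonom sigma_one)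
qed

lemma support_lattice_Zx_lattice:
  assumes "sigma_field \<sigma>"
  shows "Zx_lattice (support_lattice I)"
proof -
  interpret sigma_field \<sigma> by fact
  let ?S = "support_lattice I"
  have zero: "0 \<in> ?S"
    using binomial_zero by (auto simp: support_lattice_def intro!: exI[of _ 1])
  have add: "f + g \<in> ?S" if "f \<in> ?S" "g \<in> ?S" for f g
    using that binomial_add by (auto simp: support_lattice_def) (metis no_zero_divisors)
  have neg: "- f \<in> ?S" if "f \<in> ?S" for f
    using that binomial_neg by (auto simp: support_lattice_def) (metis nonzero_imp_inverse_nonzero)
  have x: "xvar *s f \<in> ?S" if "f \<in> ?S" for f
    using that binomial_sigma[OF assms] by (auto simp: support_lattice_def) (metis sigma_eq_0_iff)
  have nat: "of_nat m *s f \<in> ?S" if "f \<in> ?S" for m f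
    by (induction m) (use zero add that in \<open>auto simp: Zx.scale_left_distrib\<close>)
  have int: "of_int k *s f \<in> ?S" if "f \<in> ?S" for k f
    using nat[OF that, of "nat k"] neg[OF nat[OF that, of "nat (- k)"]]
    by (cases "k \<ge> 0") (simp_all add: Zx.scale_minus_left)
  have "p *s f \<in> ?S" if "f \<in> ?S" for p f
  proof (induction p)
    case (pCons a p)
    have "pCons a p = of_int a + xvar * p" by (simp add: of_int_poly)
    then have "pCons a p *s f = of_int a *s f + xvar *s (p *s f)"
      by (simp only: Zx.scale_left_distrib Zx.scale_scale)
    then show ?case using add[OF int[OF that] x[OF pCons.IH]] by (simp only:)
  qed (use zero in simp)
  then show ?thesis using zero add by (auto simp: Zx_lattice_iff)
qed

end

text \<open>
  The reason for M-saturation. Modulo \<open>\<bbbY>\<^sup>f - d z\<^sup>i\<close> both \<open>\<bbbY>\<^sup>x\<^sup>f\<close> and \<open>(\<sigma>(d)/d\<^sup>k) \<bbbY>\<^sup>k\<^sup>f\<close> become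
  \<open>\<sigma>(d) z\<^sup>i\<^sup>k\<close>, and the product of these binomials over \<open>i < m\<close> lies in \<open>I\<close>. The constant is
  determined by \<open>d\<close>; this compatibility is what makes the characters in
  \<open>vanishing_ideal_perfect_if_extensions_equivariant\<close> commute with \<open>\<sigma>\<close>.
\<close>

lemma perfect_sigma_ideal_root_of_binomial:
  fixes f :: "int poly ^ 'n" and d :: "'a::{alg_closed_field, field_char_0}"
  assumes "sigma_field \<sigma>" and I: "perfect_sigma_ideal \<sigma> I"
    and z: "primitive_root_of_unity m z" and zk: "\<sigma> z = z ^ k" and d: "d \<noteq> 0"
    and mem: "lmonom 1 (of_nat m *s f) - lconst (d ^ m) \<in> I"
  shows "lmonom 1 ((xvar - of_nat k) *s f) - lconst (\<sigma> d / d ^ k) \<in> I"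
proof -
  interpret sigma_field \<sigma> by fact
  define e where "e = \<sigma> d / d ^ k"
  define g where "g = lmonom 1 (xvar *s f) - lmonom e (of_nat k *s f)"
  have "g \<in> I"
  proof (rule perfect_sigma_ideal_split[OF finite_lessThan I])
    show "(\<Prod>i<m. lmonom 1 f - lconst (d * z ^ i)) \<in> I"
      using mem by (simp only: binomial_factorization[OF z d])
  next
    fix i I' assume I': "perfect_sigma_ideal \<sigma> I'" and mem': "lmonom 1 f - lconst (d * z ^ i) \<in> I'"
    note ideal = perfect_sigma_idealD(1)[OF I']
    note ID = sigma_idealD[OF ideal]
    let ?w = "d * z ^ i"
    have "\<sigma> ?w = \<sigma> d * (z ^ k) ^ i" by (simp add: sigma_mult sigma_power zk)
    also have "\<dots> = e * ?w ^ k"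
      using d by (simp add: e_def power_mult_distrib mult.commute flip: power_mult)
    finally have w: "\<sigma> ?w = e * ?w ^ k" .
    have "g = (lmonom 1 (xvar *s f) - lconst (\<sigma> ?w)) - lconst e * (lmonom 1 (of_nat k *s f) - lconst (?w ^ k))"
      by (simp only: w) (simp add: g_def right_diff_distrib mult_single)
    also have "\<dots> \<in> I'"
      using ID(5)[OF binomial_sigma[OF ideal assms(1) mem'] ID(3)[OF binomial_of_nat[OF ideal mem']]] .
    finally show "g \<in> I'" .
  qed
  then have "lmonom 1 (- (of_nat k *s f)) * g \<in> I"
    using sigma_idealD(3)[OF perfect_sigma_idealD(1)[OF I]] by blast
  moreover have "lmonom 1 (- (of_nat k *s f)) * g = lmonom 1 ((xvar - of_nat k) *s f) - lconst e"
    by (simp add: g_def right_diff_distrib mult_single Zx.scale_left_diff_distrib)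
  ultimately show ?thesis by (simp add: e_def)
qed

text \<open>
  For \<open>m = 1\<close> the root is \<open>1\<close>, and \<open>1 = 1\<^sup>0\<close> agrees with the convention for the exponent.
\<close>

lemma sigma_exponent_primitive_root:
  assumes "sigma_field \<sigma>" and \<zeta>: "\<And>m. m \<ge> 2 \<Longrightarrow> primitive_root_of_unity m (\<zeta> m)" and "m \<ge> 1"
  obtains z where "primitive_root_of_unity m z" "\<sigma> z = z ^ sigma_exponent \<sigma> \<zeta> m"
proof (cases "m = 1")
  case True
  show ?thesis
    by (rule that[of 1]) (use True sigma_field.sigma_one[OF assms(1)] in \<open>auto simp: primitive_root_of_unity_def\<close>)
next
  case False
  then have prim: "primitive_root_of_unity m (\<zeta> m)" using \<zeta> \<open>m \<ge> 1\<close> by simp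
  have "\<sigma> (\<zeta> m) = \<zeta> m ^ sigma_exponent \<sigma> \<zeta> m"
    using theI'[OF sigma_exponent_ex1[OF assms(1) prim]] False by (simp add: sigma_exponent_def)
  with prim show ?thesis by (rule that)
qed

lemma support_lattice_P_saturated:
  fixes I :: "('a::{alg_closed_field, field_char_0}, 'n::finite) laurent set"
  assumes "inversive_sigma_field \<sigma>" and \<zeta>: "\<And>m. m \<ge> 2 \<Longrightarrow> primitive_root_of_unity m (\<zeta> m)"
    and I: "perfect_sigma_ideal \<sigma> I"
  shows "P_saturated_lattice \<sigma> \<zeta> (support_lattice I)"
  unfolding P_saturated_lattice_def
proof (intro conjI)
  interpret inversive_sigma_field \<sigma> by fact
  have sf: "sigma_field \<sigma>" ..
  note ideal = perfect_sigma_idealD(1)[OF I]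
  show "Zx_lattice (support_lattice I)" by (rule support_lattice_Zx_lattice[OF ideal sf])
  show "x_saturated (support_lattice I)"
    unfolding x_saturated_def
  proof (intro allI impI)
    fix f assume "xvar *s f \<in> support_lattice I"
    then obtain c where c: "c \<noteq> 0" "lmonom 1 (xvar *s f) - lconst c \<in> I" by (auto simp: support_lattice_def)
    have "laurent_sigma \<sigma> (lmonom 1 f - lconst (inv \<sigma> c)) \<in> I"
      using c by (simp add: laurent_sigma_diff laurent_sigma_lmonom sigma_one sigma_inv)
    then have "lmonom 1 f - lconst (inv \<sigma> c) \<in> I" by (rule perfect_sigma_ideal_reflexive[OF I])
    moreover have "inv \<sigma> c \<noteq> 0" using c(1) sigma_inv[of c] sigma_zero by metis
    ultimately show "f \<in> support_lattice I" by (auto simp: support_lattice_def)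
  qed
  show "M_saturated \<sigma> \<zeta> (support_lattice I)"
    unfolding M_saturated_def
  proof (intro allI impI)
    fix m :: nat and f assume m: "1 \<le> m" and "of_nat m *s f \<in> support_lattice I"
    then obtain c where c: "c \<noteq> 0" "lmonom 1 (of_nat m *s f) - lconst c \<in> I" by (auto simp: support_lattice_def)
    obtain d where d: "d ^ m = c" using nth_root_exists[of m c] m by auto
    have d0: "d \<noteq> 0" using d c(1) m by (auto simp: power_0_left)
    obtain z where z: "primitive_root_of_unity m z" "\<sigma> z = z ^ sigma_exponent \<sigma> \<zeta> m"
      by (rule sigma_exponent_primitive_root[OF sf \<zeta> m]) (assumption, rule that)
    have "\<sigma> d / d ^ sigma_exponent \<sigma> \<zeta> m \<noteq> 0" using d0 by (simp add: sigma_eq_0_iff)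
    moreover have "lmonom 1 (of_nat m *s f) - lconst (d ^ m) \<in> I" using c d by simp
    ultimately show "(xvar - of_nat (sigma_exponent \<sigma> \<zeta> m)) *s f \<in> support_lattice I"
      using perfect_sigma_ideal_root_of_binomial[OF sf I z d0] unfolding support_lattice_def by blast
  qed
qed

section \<open>Perfect ideals from P-saturated lattices\<close>

definition Z_saturation :: "(int poly ^ 'n) set \<Rightarrow> (int poly ^ 'n) set" where
  "Z_saturation L = {f. \<exists>m\<ge>1. of_nat m *s f \<in> L}"

lemma Z_saturation_lattice:
  assumes L: "Zx_lattice L" shows "Zx_lattice (Z_saturation L)"
  unfolding Zx_lattice_iff
proof (intro conjI ballI allI)
  note LD = Zx_latticeD[OF L]
  show "0 \<in> Z_saturation L" using LD(1) by (auto simp: Z_saturation_def intro!: exI[of _ 1])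
  fix f assume "f \<in> Z_saturation L"
  then obtain m where m: "m \<ge> 1" "of_nat m *s f \<in> L" by (auto simp: Z_saturation_def)
  {
    fix g assume "g \<in> Z_saturation L"
    then obtain l where l: "l \<ge> 1" "of_nat l *s g \<in> L" by (auto simp: Z_saturation_def)
    have "of_nat (m * l) *s (f + g) = of_nat l *s (of_nat m *s f) + of_nat m *s (of_nat l *s g)"
      by (simp add: Zx.scale_right_distrib mult.commute)
    then have "of_nat (m * l) *s (f + g) \<in> L" using LD(2)[OF LD(3)[OF m(2)] LD(3)[OF l(2)]] by (simp only:)
    moreover have "m * l \<ge> 1" using m l by simp
    ultimately show "f + g \<in> Z_saturation L" unfolding Z_saturation_def by blast
  next
    fix p :: "int poly"
    have "of_nat m *s (p *s f) = p *s (of_nat m *s f)" by (simp add: mult.commute)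
    then have "of_nat m *s (p *s f) \<in> L" using LD(3)[OF m(2)] by (simp only:)
    then show "p *s f \<in> Z_saturation L" using m unfolding Z_saturation_def by blast
  }
qed

lemma subset_Z_saturation: "L \<subseteq> Z_saturation L"
  by (auto simp: Z_saturation_def intro!: exI[of _ 1])

lemma Z_saturated_Z_saturation: "Z_saturated (Z_saturation L)"
  unfolding Z_saturated_def
proof (intro allI impI)
  fix m :: nat and f assume m: "1 \<le> m" "of_nat m *s f \<in> Z_saturation L"
  then obtain l where "l \<ge> 1" "of_nat l *s (of_nat m *s f) \<in> L" by (auto simp: Z_saturation_def)
  then have "l * m \<ge> 1" "of_nat (l * m) *s f \<in> L" using m by simp_all
  then show "f \<in> Z_saturation L" unfolding Z_saturation_def by blast
qed

lemma x_saturated_Z_saturation: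
  assumes "x_saturated L" shows "x_saturated (Z_saturation L)"
  unfolding x_saturated_def
proof (intro allI impI)
  fix f assume "xvar *s f \<in> Z_saturation L"
  then obtain m where m: "m \<ge> 1" "of_nat m *s (xvar *s f) \<in> L" by (auto simp: Z_saturation_def)
  have "xvar *s (of_nat m *s f) \<in> L" using m(2) by (simp add: mult.commute)
  then have "of_nat m *s f \<in> L" using assms unfolding x_saturated_def by blast
  then show "f \<in> Z_saturation L" using m(1) unfolding Z_saturation_def by blast
qed

text \<open>
  Every point of the ideal of \<open>L\<close> is a point of the ideal of one of the extensions of the character
  to the saturation, so the former is the intersection of the latter. These are perfect, because the
  saturation is both \<open>\<int>\<close>-saturated and \<open>x\<close>-saturated.
\<close>

lemma vanishing_ideal_perfect_if_extensions_equivariant: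
  fixes \<theta> :: "int poly ^ 'n \<Rightarrow> 'a::{alg_closed_field, field_char_0}"
  assumes \<sigma>: "inversive_sigma_field \<sigma>" and pc: "partial_character \<sigma> L \<theta>" and xsat: "x_saturated L"
    and ext: "\<And>\<theta>' f. group_char \<theta>' \<Longrightarrow> \<forall>g\<in>L. \<theta>' g = \<theta> g \<Longrightarrow> f \<in> Z_saturation L \<Longrightarrow>
      \<theta>' (xvar *s f) = \<sigma> (\<theta>' f)"
  shows "perfect_sigma_ideal \<sigma> (vanishing_ideal L \<theta>)"
  unfolding perfect_sigma_ideal_def
proof (intro conjI allI impI)
  show "sigma_ideal \<sigma> (vanishing_ideal L \<theta>)" by (rule vanishing_ideal_sigma_ideal[OF \<sigma> pc])
  fix p a assume a: "a \<noteq> 0 \<and> sigma_power \<sigma> p a \<in> vanishing_ideal L \<theta>"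
  have L: "Zx_lattice L" using pc by (simp add: partial_character_def)
  have "char_eval \<theta>' p = 0" if \<theta>': "group_char \<theta>'" "\<forall>g\<in>L. \<theta>' g = \<theta> g" for \<theta>'
  proof -
    let ?S = "Z_saturation L"
    have "partial_character \<sigma> ?S \<theta>'"
      using Z_saturation_lattice[OF L] ext[OF \<theta>'] group_charD(2,3)[OF \<theta>'(1)]
      by (auto simp: partial_character_def)
    then have perf: "perfect_sigma_ideal \<sigma> (vanishing_ideal ?S \<theta>')"
      by (rule vanishing_ideal_perfect[OF \<sigma> _ Z_saturated_Z_saturation x_saturated_Z_saturation[OF xsat] \<theta>'(1)])
    have "vanishing_ideal L \<theta> \<subseteq> vanishing_ideal ?S \<theta>'"
      using \<theta>'(2) subset_Z_saturation[of L] unfolding vanishing_ideal_def by (auto simp: subset_iff)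
    then have "p \<in> vanishing_ideal ?S \<theta>'" using perfect_sigma_idealD(2)[OF perf] a by blast
    then show ?thesis using vanishing_idealD[OF _ \<theta>'(1)] by blast
  qed
  then show "p \<in> vanishing_ideal L \<theta>" by (auto simp: vanishing_ideal_def)
qed

lemma vanishing_ideal_eq_character_ideal:
  fixes \<theta> :: "int poly ^ 'n \<Rightarrow> 'a::{alg_closed_field, field_char_0}"
  assumes \<sigma>: "inversive_sigma_field \<sigma>" and pc: "partial_character \<sigma> L \<theta>" and \<theta>: "group_char \<theta>"
  shows "vanishing_ideal L \<theta> = character_ideal \<sigma> L \<theta>"
proof
  have L: "Zx_lattice L" using pc by (simp add: partial_character_def)
  let ?G = "{lmonom 1 f - lconst (\<theta> f) | f. f \<in> L}"
  have "sigma_ideal \<sigma> (generated_sigma_ideal \<sigma> ?G)" by (rule sigma_ideal_generated)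
  note ID = sigma_idealD[OF this]
  have G: "?G \<subseteq> generated_sigma_ideal \<sigma> ?G" unfolding generated_sigma_ideal_def by (rule hull_subset)
  show "vanishing_ideal L \<theta> \<subseteq> character_ideal \<sigma> L \<theta>"
    unfolding character_ideal_def
    by (rule vanishing_ideal_generated[OF L \<theta>])
      (rule ID(1), erule (1) ID(2), erule ID(3), use G in blast)
  show "character_ideal \<sigma> L \<theta> \<subseteq> vanishing_ideal L \<theta>"
    unfolding character_ideal_def generated_sigma_ideal_def
    using vanishing_ideal_support[OF L \<theta>]
    by (intro hull_minimal vanishing_ideal_sigma_ideal[OF \<sigma> pc]) auto
qed

lemma character_ideal_binomial: "laurent_binomial_sigma_ideal \<sigma> (character_ideal \<sigma> L \<rho>)"
  unfolding laurent_binomial_sigma_ideal_def character_ideal_def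
proof (intro exI[of _ "{lmonom 1 f - lconst (\<rho> f) | f. f \<in> L}"] conjI refl subsetI)
  fix p assume "p \<in> {lmonom 1 f - lconst (\<rho> f) | f. f \<in> L}"
  then obtain f where "p = lmonom 1 f + lmonom (- \<rho> f) 0" by (auto simp: single_uminus)
  then show "p \<in> {lmonom a g + lmonom b h | a b g h. True}" by blast
qed

section \<open>The perfect closure\<close>

theorem theorem4p52:
  fixes \<sigma> :: "'a::{alg_closed_field, field_char_0} \<Rightarrow> 'a"
    and \<zeta> :: "nat \<Rightarrow> 'a"
    and L :: "(int poly ^ 'n) set"
    and \<rho> :: "int poly ^ 'n \<Rightarrow> 'a"
  assumes "inversive_sigma_field \<sigma>"
    and "\<And>m. m \<ge> 2 \<Longrightarrow> primitive_root_of_unity m (\<zeta> m)"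
    and "partial_character \<sigma> L \<rho>"
  shows "perfect_closure \<sigma> (character_ideal \<sigma> L \<rho>) = generated_sigma_ideal \<sigma> {1} \<or>
    (laurent_binomial_sigma_ideal \<sigma> (perfect_closure \<sigma> (character_ideal \<sigma> L \<rho>)) \<and>
     support_lattice (perfect_closure \<sigma> (character_ideal \<sigma> L \<rho>)) = sat_P \<sigma> \<zeta> L)"
proof -
  interpret inversive_sigma_field \<sigma> by fact
  have sf: "sigma_field \<sigma>" ..
  define J where "J = perfect_closure \<sigma> (character_ideal \<sigma> L \<rho>)"
  have J: "perfect_sigma_ideal \<sigma> J" unfolding J_def by (rule perfect_sigma_ideal_closure)
  note ideal = perfect_sigma_idealD(1)[OF J]
  note ID = sigma_idealD[OF ideal]
  have gen: "lmonom 1 f - lconst (\<rho> f) \<in> J" if "f \<in> L" for f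
  proof -
    have "lmonom 1 f - lconst (\<rho> f) \<in> character_ideal \<sigma> L \<rho>"
      unfolding character_ideal_def generated_sigma_ideal_def using that by (intro hull_inc) auto
    then show ?thesis unfolding J_def perfect_closure_def by (rule hull_inc)
  qed
  show ?thesis
  proof (cases "1 \<in> J")
    case True
    have "J = UNIV" using ID(3)[OF True] by auto
    moreover have one: "1 \<in> generated_sigma_ideal \<sigma> {1 :: ('a, 'n) laurent}"
      unfolding generated_sigma_ideal_def by (rule hull_inc) simp
    have "generated_sigma_ideal \<sigma> {1 :: ('a, 'n) laurent} = UNIV"
      using sigma_idealD(3)[OF sigma_ideal_generated one] by auto
    ultimately show ?thesis by (simp add: J_def)
  next
    case False
    note unique = binomial_unique[OF ideal False]
    define L' where "L' = sat_P \<sigma> \<zeta> L"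
    have sat: "P_saturated_lattice \<sigma> \<zeta> L'" unfolding L'_def by (rule sat_P_P_saturated)
    then have L': "Zx_lattice L'" and xsat: "x_saturated L'" and Msat: "M_saturated \<sigma> \<zeta> L'"
      by (auto simp: P_saturated_lattice_def)
    have LL': "L \<subseteq> L'" unfolding L'_def sat_P_def by (rule hull_subset)
    have "L' \<subseteq> support_lattice J"
      unfolding L'_def sat_P_def
    proof (rule hull_minimal)
      show "L \<subseteq> support_lattice J"
        using gen assms(3) by (auto simp: support_lattice_def partial_character_def)
      show "P_saturated_lattice \<sigma> \<zeta> (support_lattice J)"
        by (rule support_lattice_P_saturated[OF assms(1) assms(2) J])
    qed
    then have "\<forall>f\<in>L'. \<exists>c. c \<noteq> 0 \<and> lmonom 1 f - lconst c \<in> J" by (auto simp: support_lattice_def)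
    then obtain \<rho>' where \<rho>': "\<And>f. f \<in> L' \<Longrightarrow> \<rho>' f \<noteq> 0" "\<And>f. f \<in> L' \<Longrightarrow> lmonom 1 f - lconst (\<rho>' f) \<in> J"
      by metis
    have \<rho>'_add: "\<rho>' (f + g) = \<rho>' f * \<rho>' g" if "f \<in> L'" "g \<in> L'" for f g
      using unique[OF \<rho>'(2)[OF Zx_latticeD(2)[OF L' that]] binomial_add[OF ideal \<rho>'(2)[OF that(1)] \<rho>'(2)[OF that(2)]]] .
    have \<rho>'_x: "\<rho>' (xvar *s f) = \<sigma> (\<rho>' f)" if "f \<in> L'" for f
      using unique[OF \<rho>'(2)[OF Zx_latticeD(3)[OF L' that]] binomial_sigma[OF ideal sf \<rho>'(2)[OF that]]] .
    \<comment> \<open>The constants that occur in \<open>J\<close> form a character on \<open>L'\<close>, because \<open>J\<close> is proper; extend it to the whole group.\<close>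
    obtain \<theta> where \<theta>: "group_char \<theta>" and \<theta>\<rho>': "\<And>f. f \<in> L' \<Longrightarrow> \<theta> f = \<rho>' f"
      by (rule group_char_extends[OF L' \<rho>'(1) \<rho>'_add]) (assumption, assumption, assumption, rule that)
    have pc: "partial_character \<sigma> L' \<theta>"
      unfolding partial_character_def
    proof (intro conjI ballI)
      show "Zx_lattice L'" by (rule L')
      show "\<theta> f \<noteq> 0" "\<theta> (f + g) = \<theta> f * \<theta> g" for f g by (rule group_charD[OF \<theta>])+
      show "\<theta> (xvar *s f) = \<sigma> (\<theta> f)" if "f \<in> L'" for f
        using \<theta>\<rho>'[OF that] \<theta>\<rho>'[OF Zx_latticeD(3)[OF L' that]] \<rho>'_x[OF that] by simp
    qed
    define V where "V = vanishing_ideal L' \<theta>"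
    have VJ: "V \<subseteq> J" unfolding V_def
    proof (rule vanishing_ideal_generated[OF L' \<theta> ID(1)])
      show "lmonom 1 f - lconst (\<theta> f) \<in> J" if "f \<in> L'" for f using \<rho>'(2)[OF that] \<theta>\<rho>'[OF that] by simp
    qed (erule (1) ID(2), erule ID(3))
    have "perfect_sigma_ideal \<sigma> V"
      unfolding V_def
    proof (rule vanishing_ideal_perfect_if_extensions_equivariant[OF assms(1) pc xsat])
      fix \<theta>' f assume \<theta>': "group_char \<theta>'" "\<forall>g\<in>L'. \<theta>' g = \<theta> g" and "f \<in> Z_saturation L'"
      then obtain m where m: "1 \<le> m" "of_nat m *s f \<in> L'" by (auto simp: Z_saturation_def)
      let ?k = "sigma_exponent \<sigma> \<zeta> m"
      let ?h = "(xvar - of_nat ?k) *s f"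
      note \<theta>'D = group_charD[OF \<theta>'(1)]
      obtain z where z: "primitive_root_of_unity m z" "\<sigma> z = z ^ ?k"
        by (rule sigma_exponent_primitive_root[OF sf assms(2) m(1)]) (assumption, rule that)
      have "\<theta>' g = \<rho>' g" if "g \<in> L'" for g using \<theta>'(2) \<theta>\<rho>'[OF that] that by simp
      note \<theta>'\<rho>' = this
      have "lmonom 1 (of_nat m *s f) - lconst (\<theta>' f ^ m) \<in> J"
        using \<rho>'(2)[OF m(2)] \<theta>'\<rho>'[OF m(2)] \<theta>'D(6) by (simp only:)
      \<comment> \<open>The value forced on \<open>\<theta>'\<close> at \<open>(x - o) f\<close> is the constant that \<open>J\<close> assigns to it.\<close>
      then have root: "lmonom 1 ?h - lconst (\<sigma> (\<theta>' f) / \<theta>' f ^ ?k) \<in> J"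
        by (rule perfect_sigma_ideal_root_of_binomial[OF sf J z \<theta>'D(3)])
      have h: "?h \<in> L'" using Msat m unfolding M_saturated_def by blast
      have "\<theta>' (xvar *s f) / \<theta>' f ^ ?k = \<theta>' ?h"
        by (simp only: Zx.scale_left_diff_distrib \<theta>'D(5,6))
      also have "\<dots> = \<rho>' ?h" by (rule \<theta>'\<rho>'[OF h])
      also have "\<dots> = \<sigma> (\<theta>' f) / \<theta>' f ^ ?k" by (rule unique[OF \<rho>'(2)[OF h] root])
      finally show "\<theta>' (xvar *s f) = \<sigma> (\<theta>' f)" using \<theta>'D(3)[of f] by simp
    qed
    moreover have "character_ideal \<sigma> L \<rho> \<subseteq> V"
      unfolding character_ideal_def generated_sigma_ideal_def
    proof (rule hull_minimal)
      show "sigma_ideal \<sigma> V" unfolding V_def by (rule vanishing_ideal_sigma_ideal[OF assms(1) pc])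
      show "{lmonom 1 f - lconst (\<rho> f) | f. f \<in> L} \<subseteq> V"
      proof
        fix p assume "p \<in> {lmonom 1 f - lconst (\<rho> f) | f. f \<in> L}"
        then obtain f where p: "p = lmonom 1 f - lconst (\<rho> f)" and f: "f \<in> L" by blast
        have f': "f \<in> L'" using f LL' by blast
        have "\<rho> f = \<theta> f" using unique[OF gen[OF f] \<rho>'(2)[OF f']] \<theta>\<rho>'[OF f'] by simp
        then show "p \<in> V" unfolding V_def p using vanishing_ideal_support[OF L' \<theta>] f' by blast
      qed
    qed
    ultimately have "J \<subseteq> V" unfolding J_def perfect_closure_def by (intro hull_minimal)
    with VJ have JV: "J = V" by blast
    have "V = character_ideal \<sigma> L' \<theta>"
      unfolding V_def by (rule vanishing_ideal_eq_character_ideal[OF assms(1) pc \<theta>])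
    then have "laurent_binomial_sigma_ideal \<sigma> J" by (simp add: JV character_ideal_binomial)
    moreover have "support_lattice J = L'"
      using vanishing_ideal_support[OF L' \<theta>] group_charD(3)[OF \<theta>]
      by (auto simp: JV V_def support_lattice_def)
    ultimately show ?thesis by (simp add: J_def L'_def)
  qed
qed

end
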